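(* Let $\mathfrak{F}\subseteq\mathfrak{F}_{\mathrm{all}}$ satisfy $\mathfrak{F}\supseteq\mathfrak{F}_{\mathrm{AR}(2)}$. Let $T$ be a nonsphericity-corrected F-type test statistic based on $\check\beta$ and $\check\Omega$, where $(\check\beta,\check\Omega,N)$ satisfies the estimator conditions with $N=\emptyset$. Furthermore, assume that $\check\Omega(y)$ is nonnegative definite for every $y\in\mathbb{R}^n$. Suppose there exists a $\gamma\in[0,\pi]$ such that $\mathrm{span}(E_{n,\rho(\gamma)}(\gamma))\subseteq\mathrm{span}(X)$, where $\rho(\gamma)=\rho(\gamma,\mathfrak{M}_0^{lin})$. Then $\kappa(\underline{\omega}(\mathfrak{M}_0^{lin}),\underline{d}(\mathfrak{M}_0^{lin}))+\kappa(\gamma,1)<n$ holds, and we have $$\sup_{f\in\mathfrak{F}}P_{\mu_0,\sigma^2\Sigma(f)}(T\ge C)=1$$ for every critical value $C$, $-\infty<C<\infty$, for every $\mu_0\in\mathfrak{M}_0$, and for every $\sigma^2\in(0,\infty)$.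
   Context: Model: $n,k,q$ are positive integers with $1\le k<n$; $X\in\mathbb{R}^{n\times k}$ is a fixed matrix of rank $k$; $R\in\mathbb{R}^{q\times k}$ has rank $q\ge 1$; $r\in\mathbb{R}^q$. (One tests $R\beta=r$ in $\mathbf{Y}=X\beta+\mathbf{U}$, $\mathbf{U}\sim N(0,\sigma^2\Sigma(f))$, $0<\sigma^2<\infty$, $f\in\mathfrak{F}$.) Here $\mathrm{span}(\cdot)$ is column space, $'$ is transpose, $\mathfrak{M}=\mathrm{span}(X)$, $\mathfrak{M}_0=\{X\beta:R\beta=r\}$, $\mathfrak{M}_0^{lin}=\{X\beta:R\beta=0\}$. $P_{\mu,A}$ is the Gaussian measure on $\mathbb{R}^n$ with mean $\mu$ and covariance $A$; $P(T\ge C)$ means $P(\{y:T(y)\ge C\})$. $\lambda_{\mathbb{R}^n}$ is Lebesgue measure. Spectral densities: $\mathfrak{F}_{\mathrm{all}}$ is the set of all normalized spectral densities of real weakly stationary processes (nonnegative, even, integrable $f$ on $[-\pi,\pi]$ with $\int_{-\pi}^{\pi}f=1$); $\mathfrak{F}_{\mathrm{AR}(2)}$ is the subset of those corresponding to stationary autoregressive processes of order at most two; $\Sigma(f)=\left[\int_{-\pi}^{\pi}e^{-\iota(j-l)\omega}f(\omega)d\omega\right]_{j,l=1}^n$, $\iota$ the imaginary unit. For $\omega\in[0,\pi]$ and integer $s\ge0$, $E_{n,s}(\omega)$ is the $n\times2$ matrix with $j$-th row $(j^s\cos(j\omega),j^s\sin(j\omega))$. For a linear subspace $\mathcal{L}$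 of $\mathbb{R}^n$ with $\dim\mathcal{L}<n$, $\rho(\omega,\mathcal{L})=\min\{s\in\mathbb{N}\cup\{0\}:\mathrm{span}(E_{n,s}(\omega))\nsubseteq\mathcal{L}\}$ (well-defined; positive for at most finitely many $\omega\in[0,\pi]$). Let $\omega_1(\mathcal{L})<\dots<\omega_{p(\mathcal{L})}(\mathcal{L})$ be the elements of $\{\omega\in[0,\pi]:\rho(\omega,\mathcal{L})>0\}$ and $d_i(\mathcal{L})=\rho(\omega_i(\mathcal{L}),\mathcal{L})$, with $p(\mathcal{L})=0$ if this set is empty; $\underline{\omega}(\mathcal{L})$, $\underline{d}(\mathcal{L})$ are the corresponding vectors. Put $\kappa(\omega,d)=2d$ for $\omega\in(0,\pi)$, $\kappa(\omega,d)=d$ for $\omega\in\{0,\pi\}$, and $\kappa(\underline{\omega}(\mathcal{L}),\underline{d}(\mathcal{L}))=\sum_{i=1}^{p(\mathcal{L})}\kappa(\omega_i(\mathcal{L}),d_i(\mathcal{L}))$ (zero if $p(\mathcal{L})=0$). Estimator conditions on $(\check\beta,\check\Omega,N)$: (i) $\check\beta:\mathbb{R}^n\setminus N\to\mathbb{R}^k$ and $\check\Omega:\mathbb{R}^n\setminus N\to\mathbb{R}^{q\times q}$ are well-defined and continuous on $\mathbb{R}^n\setminus N$, where $N$ is a closed $\lambda_{\mathbb{R}^n}$-null set, and $\check\Omega(y)$ is symmetric for every $y\in\mathbb{R}^n\setminus N$; (ii) $y\in\mathbb{R}^n\setminus N$ implies $\delta y+X\eta\in\mathbb{R}^n\setminus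 N$ for all $\delta\ne0$, $\eta\in\mathbb{R}^k$; (iii) $\check\beta(\delta y+X\eta)=\delta\check\beta(y)+\eta$ and $\check\Omega(\delta y+X\eta)=\delta^2\check\Omega(y)$ for all $y\in\mathbb{R}^n\setminus N$, $\delta\neq0$, $\eta\in\mathbb{R}^k$; (iv) $\check\Omega$ is $\lambda_{\mathbb{R}^n}$-almost everywhere nonsingular on $\mathbb{R}^n\setminus N$. Nonsphericity-corrected F-type test statistic: with $N^*=N\cup\{y\in\mathbb{R}^n\setminus N:\det\check\Omega(y)=0\}$, $T(y)=(R\check\beta(y)-r)'\check\Omega^{-1}(y)(R\check\beta(y)-r)$ for $y\in\mathbb{R}^n\setminus N^*$ and $T(y)=0$ for $y\in N^*$. *)

theory Defs
  imports "HOL-Probability.Probability"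
begin

(* R^n is real^'n with n = CARD('n).  The order on the index type 'n enumerates the
   coordinates; row_no j is the position of j in it, ranging over 1, ..., n. *)

definition row_no :: "'n::{finite,linorder} \<Rightarrow> nat" where
  "row_no j = card {..j}"

definition col_span :: "real^'m^'n \<Rightarrow> (real^'n) set" where
  "col_span A = span (columns A)"

definition nonneg_definite :: "real^'n^'n \<Rightarrow> bool" where
  "nonneg_definite A \<longleftrightarrow> (\<forall>v. 0 \<le> v \<bullet> (A *v v))"


section \<open>Gaussian measures\<close>

definition std_gaussian :: "(real^'n) measure" where
  "std_gaussian = density lborel (\<lambda>z. ennreal (\<Prod>i\<in>UNIV. std_normal_density (z $ i)))"

(* The law of mu + B Z with Z standard Gaussian and B B' = A.  Such a B exists for every
   symmetric nonnegative definite A (singular or not), and the law does not depend on the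
   choice of B. *)
definition gaussian_measure :: "real^'n \<Rightarrow> real^'n^'n \<Rightarrow> (real^'n) measure" where
  "gaussian_measure \<mu> A =
     distr std_gaussian borel
       (\<lambda>z. \<mu> + (SOME B :: real^'n^'n. B ** transpose B = A) *v z)"


section \<open>Spectral densities\<close>

(* A density is a function on [-pi, pi]; it is represented by its extension by 0 to the
   real line, so that distinct members are distinct functions on [-pi, pi]. *)
definition spec_all :: "(real \<Rightarrow> real) set" where
  "spec_all = {f. (\<forall>\<omega>\<in>{-pi..pi}. 0 \<le> f \<omega>) \<and>
                  (\<forall>\<omega>\<in>{-pi..pi}. f (- \<omega>) = f \<omega>) \<and>
                  (\<forall>\<omega>. \<omega> \<notin> {-pi..pi} \<longrightarrow> f \<omega> = 0) \<and>
                  set_integrable lebesgue {-pi..pi} f \<and>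
                  (LINT \<omega>:{-pi..pi}|lebesgue. f \<omega>) = 1}"

(* Spectral densities of y_t = a y_(t-1) + b y_(t-2) + e_t with white noise e_t.  The
   stationarity condition is the usual one (no zeros of 1 - a z - b z^2 in the closed unit
   disc); excluding only zeros on the unit circle yields the same set of densities, because
   reflecting zeros at the circle changes the modulus on it by a constant factor only.  The
   case b = 0, and a = b = 0, gives the lower orders. *)
definition spec_AR2 :: "(real \<Rightarrow> real) set" where
  "spec_AR2 = {f \<in> spec_all. \<exists>a b c :: real. 0 < c \<and>
      (\<forall>z::complex. norm z \<le> 1 \<longrightarrow> 1 - of_real a * z - of_real b * z ^ 2 \<noteq> 0) \<and>
      (\<forall>\<omega>\<in>{-pi..pi}. f \<omega> =
         c / (norm (1 - of_real a * exp (- \<i> * of_real \<omega>)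
                      - of_real b * exp (- 2 * \<i> * of_real \<omega>))) ^ 2)}"

(* The integral is real since f is even; Re only converts the type. *)
definition Sigma_mat :: "(real \<Rightarrow> real) \<Rightarrow> real^('n::{finite,linorder})^('n::{finite,linorder})" where
  "Sigma_mat f = (\<chi> j l. Re (LINT \<omega>:{-pi..pi}|lebesgue.
      exp (- \<i> * of_real ((real (row_no j) - real (row_no l)) * \<omega>)) * of_real (f \<omega>)))"


section \<open>The quantities rho and kappa\<close>

definition E_mat :: "nat \<Rightarrow> real \<Rightarrow> real^2^('n::{finite,linorder})" where
  "E_mat s \<omega> = (\<chi> j. vector [real (row_no j) ^ s * cos (real (row_no j) * \<omega>),
                             real (row_no j) ^ s * sin (real (row_no j) * \<omega>)])"

definition rho :: "real \<Rightarrow> (real^('n::{finite,linorder})) set \<Rightarrow> nat" where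
  "rho \<omega> L = (LEAST s. \<not> col_span (E_mat s \<omega>) \<subseteq> L)"

(* The set below is finite for every proper linear subspace L. *)
definition omega_vec :: "(real^('n::{finite,linorder})) set \<Rightarrow> real list" where
  "omega_vec L = sorted_list_of_set {\<omega>\<in>{0..pi}. 0 < rho \<omega> L}"

definition d_vec :: "(real^('n::{finite,linorder})) set \<Rightarrow> nat list" where
  "d_vec L = map (\<lambda>\<omega>. rho \<omega> L) (omega_vec L)"

definition kappa :: "real \<Rightarrow> nat \<Rightarrow> nat" where
  "kappa \<omega> d = (if 0 < \<omega> \<and> \<omega> < pi then 2 * d else d)"

definition kappa_vec :: "real list \<Rightarrow> nat list \<Rightarrow> nat" where
  "kappa_vec \<omega>s ds = (\<Sum>(\<omega>, d)\<leftarrow>zip \<omega>s ds. kappa \<omega> d)"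


section \<open>The testing problem\<close>

definition M0 :: "real^'k^'n \<Rightarrow> real^'k^'q \<Rightarrow> real^'q \<Rightarrow> (real^'n) set" where
  "M0 X R r = {X *v \<beta> | \<beta>. R *v \<beta> = r}"

definition M0_lin :: "real^'k^'n \<Rightarrow> real^'k^'q \<Rightarrow> (real^'n) set" where
  "M0_lin X R = {X *v \<beta> | \<beta>. R *v \<beta> = 0}"

(* bc and Oc are total functions here; their values on N are irrelevant. *)
definition estimator_conditions ::
  "real^'k^'n \<Rightarrow> (real^'n \<Rightarrow> real^'k) \<Rightarrow> (real^'n \<Rightarrow> real^'q^'q) \<Rightarrow> (real^'n) set \<Rightarrow> bool" where
  "estimator_conditions X bc Oc N \<longleftrightarrow>
     closed N \<and> N \<in> null_sets lborel \<and>
     continuous_on (- N) bc \<and> continuous_on (- N) Oc \<and>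
     (\<forall>y. y \<notin> N \<longrightarrow> transpose (Oc y) = Oc y) \<and>
     (\<forall>y \<delta> \<eta>. y \<notin> N \<and> \<delta> \<noteq> 0 \<longrightarrow> \<delta> *\<^sub>R y + X *v \<eta> \<notin> N) \<and>
     (\<forall>y \<delta> \<eta>. y \<notin> N \<and> \<delta> \<noteq> 0 \<longrightarrow>
        bc (\<delta> *\<^sub>R y + X *v \<eta>) = \<delta> *\<^sub>R bc y + \<eta> \<and>
        Oc (\<delta> *\<^sub>R y + X *v \<eta>) = \<delta>\<^sup>2 *\<^sub>R Oc y) \<and>
     (AE y in lborel. y \<notin> N \<longrightarrow> invertible (Oc y))"

definition N_star :: "(real^'n \<Rightarrow> real^'q^'q) \<Rightarrow> (real^'n) set \<Rightarrow> (real^'n) set" where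
  "N_star Oc N = N \<union> {y. y \<notin> N \<and> det (Oc y) = 0}"

definition F_type_stat ::
  "real^'k^'q \<Rightarrow> real^'q \<Rightarrow> (real^'n \<Rightarrow> real^'k) \<Rightarrow> (real^'n \<Rightarrow> real^'q^'q) \<Rightarrow>
   (real^'n) set \<Rightarrow> real^'n \<Rightarrow> real" where
  "F_type_stat R r bc Oc N y =
     (if y \<in> N_star Oc N then 0
      else (R *v bc y - r) \<bullet> (matrix_inv (Oc y) *v (R *v bc y - r)))"

end

theory Submission
  imports Defs "HOL-Complex_Analysis.Cauchy_Integral_Theorem"
begin

text \<open>Let \<open>w \<noteq> 0\<close> be orthogonal to the column space of \<open>X\<close>. The polynomial with coefficients
  \<open>w\<close> vanishes at \<open>0\<close> and, to order \<open>\<rho>(\<omega>)\<close> (one more at \<open>\<gamma>\<close>), at \<open>exp (\<plusminus> i \<omega>)\<close>; its degree is at most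
  \<open>n\<close>, which bounds \<open>\<kappa>\<close>.

  For the size: up to a null set the rejection region contains an open set \<open>U\<close> that is invariant
  under scaling about \<open>\<mu>\<^sub>0\<close> and under translations by the linear space \<open>M\<^sub>0\<close> of the null hypothesis. Since
  the covariance estimator vanishes on the column space of \<open>X\<close>, \<open>U\<close> contains all of that space
  outside \<open>M\<^sub>0\<close> (shifted by \<open>\<mu>\<^sub>0\<close>). Choose AR(2) densities with poles approaching
  \<open>exp (\<plusminus> i (\<gamma> + h))\<close> while \<open>h\<close> tends to \<open>0\<close> much more slowly. Modulo \<open>M\<^sub>0\<close> and after rescaling
  by \<open>h\<close> to the power \<open>- \<rho>(\<gamma>)\<close>, which \<open>U\<close> does not notice, Taylor's formula shows that the Gaussian
  vectors concentrate on the span of \<open>E\<close> at \<open>s = \<rho>(\<gamma>)\<close>, \<open>\<omega> = \<gamma>\<close>, hence almost surely in \<open>U\<close>.\<close>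

section \<open>Multiplicities of zeros and the bound on kappa\<close>

lemma row_no_inj: "inj (row_no :: 'n::{finite,linorder} \<Rightarrow> nat)"
proof (rule linorder_injI)
  fix j l :: 'n
  assume "j < l"
  then have "{..j} \<subset> {..l}" by auto
  then have "row_no j < row_no l" unfolding row_no_def by (rule psubset_card_mono[OF finite])
  then show "row_no j \<noteq> row_no l" by simp
qed

lemma row_no_pos: "0 < row_no (j :: 'n::{finite,linorder})"
  unfolding row_no_def by (auto simp: card_gt_0_iff)

lemma row_no_le: "row_no (j :: 'n::{finite,linorder}) \<le> CARD('n)"
  unfolding row_no_def by (rule card_mono) auto

text \<open>The exponents start at 1, like the row numbers, so 0 is a root.\<close>

definition vec_poly :: "real^('n::{finite,linorder}) \<Rightarrow> complex poly" where
  "vec_poly w = (\<Sum>j\<in>UNIV. monom (of_real (w $ j)) (row_no j))"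

lemma coeff_vec_poly: "coeff (vec_poly w) (row_no j) = of_real (w $ j)"
  by (simp add: vec_poly_def coeff_sum coeff_monom inj_eq[OF row_no_inj])

lemma vec_poly_nz: "w \<noteq> 0 \<Longrightarrow> vec_poly w \<noteq> 0"
  by (metis coeff_0 coeff_vec_poly of_real_eq_0_iff vec_eq_iff zero_index)

lemma degree_vec_poly: "degree (vec_poly (w :: real^('n::{finite,linorder}))) \<le> CARD('n)"
  unfolding vec_poly_def
  by (intro degree_sum_le) (auto intro: order_trans[OF degree_monom_le] row_no_le)

lemma poly_vec_poly: "poly (vec_poly w) z = (\<Sum>j\<in>UNIV. of_real (w $ j) * z ^ row_no j)"
  by (simp add: vec_poly_def poly_sum poly_monom)

text \<open>This is z d/dz. It multiplies the monomial of degree j by j, so its s-fold iterate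
  produces the weights j^s of \<open>E_mat s\<close>.\<close>

definition euler_op :: "complex poly \<Rightarrow> complex poly" where
  "euler_op p = pCons 0 (pderiv p)"

lemma euler_op_monom: "euler_op (monom c k) = monom (c * of_nat k) k"
  by (rule poly_eqI) (auto simp: euler_op_def coeff_pCons coeff_pderiv coeff_monom split: nat.split)

lemma euler_op_sum: "euler_op (\<Sum>j\<in>A. f j) = (\<Sum>j\<in>A. euler_op (f j))"
proof (induction A rule: infinite_finite_induct)
  case (insert x A)
  have "euler_op (p + q) = euler_op p + euler_op q" for p q
    by (simp add: euler_op_def pderiv_add)
  with insert show ?case by simp
qed (simp_all add: euler_op_def)

lemma poly_euler_op_vec_poly:
  "poly ((euler_op ^^ s) (vec_poly w)) z =
     (\<Sum>j\<in>UNIV. of_real (w $ j) * of_nat (row_no j) ^ s * z ^ row_no j)"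
proof -
  have "(euler_op ^^ s) (vec_poly w) =
      (\<Sum>j\<in>UNIV. monom (of_real (w $ j) * of_nat (row_no j) ^ s) (row_no j))"
    by (induction s) (simp_all add: vec_poly_def euler_op_sum euler_op_monom mult_ac)
  then show ?thesis by (simp add: poly_sum poly_monom)
qed

text \<open>At a nonzero root, z d/dz lowers the multiplicity by exactly one: differentiation does
  so, and the extra factor z does not vanish there.\<close>

lemma poly_euler_op_order_nz:
  assumes "p \<noteq> 0" "z \<noteq> 0" "order z p = m"
  shows "poly ((euler_op ^^ m) p) z \<noteq> 0"
  using assms
proof (induction m arbitrary: p)
  case 0
  then show ?case by (simp add: order_root)
next
  case (Suc m)
  have root: "poly p z = 0" using Suc.prems by (simp add: order_root)
  have nz: "pderiv p \<noteq> 0"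
  proof
    assume "pderiv p = 0"
    then obtain c where "p = [:c:]" by (metis degree_0_id pderiv_eq_0_iff)
    then show False using root Suc.prems(1) by simp
  qed
  have eq: "euler_op p = [:0, 1:] * pderiv p" by (simp add: euler_op_def)
  have "order z (euler_op p) = order z [:0, 1:] + order z (pderiv p)"
    unfolding eq by (rule order_mult) (use nz in auto)
  moreover have "order z [:0, 1:] = 0"
    by (rule order_0I) (use Suc.prems in simp)
  moreover have "order z p = Suc (order z (pderiv p))"
    by (rule order_pderiv) (use Suc.prems root in auto)
  ultimately have "order z (euler_op p) = m" using Suc.prems by simp
  moreover have "euler_op p \<noteq> 0" using nz by (simp add: euler_op_def)
  ultimately show ?case using Suc.IH[of "euler_op p"] Suc.prems(2)
    by (simp add: funpow_Suc_right del: funpow.simps)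
qed

lemma le_order_if_euler_op_zero:
  assumes "p \<noteq> 0" "z \<noteq> 0" "\<And>s. s < d \<Longrightarrow> poly ((euler_op ^^ s) p) z = 0"
  shows "d \<le> order z p"
  using poly_euler_op_order_nz[OF assms(1,2) refl] assms(3) not_le by blast

lemma columns_E_mat:
  "columns (E_mat s \<omega> :: real^2^('n::{finite,linorder})) =
     {\<chi> j. real (row_no j) ^ s * cos (real (row_no j) * \<omega>),
      \<chi> j. real (row_no j) ^ s * sin (real (row_no j) * \<omega>)}"
proof -
  have "columns (E_mat s \<omega> :: real^2^('n::{finite,linorder})) = (\<lambda>i. column i (E_mat s \<omega>)) ` UNIV"
    by (auto simp: columns_def)
  then show ?thesis by (simp add: UNIV_2 column_def E_mat_def vector_2)
qed

text \<open>By de Moivre, the real and imaginary parts of both values are, up to sign, the inner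
  products of \<open>w\<close> with the columns of \<open>E_mat s \<omega>\<close>.\<close>

lemma euler_op_zero_if_perp_E_mat:
  fixes w :: "real^('n::{finite,linorder})"
  assumes "\<And>y. y \<in> col_span (E_mat s \<omega>) \<Longrightarrow> w \<bullet> y = 0"
  shows "poly ((euler_op ^^ s) (vec_poly w)) (cis \<omega>) = 0"
    and "poly ((euler_op ^^ s) (vec_poly w)) (cis (- \<omega>)) = 0"
proof -
  have "w \<bullet> y = 0" if "y \<in> columns (E_mat s \<omega>)" for y
    using assms that by (simp add: col_span_def span_base)
  then have "w \<bullet> (\<chi> j. real (row_no j) ^ s * cos (real (row_no j) * \<omega>)) = 0"
    and "w \<bullet> (\<chi> j. real (row_no j) ^ s * sin (real (row_no j) * \<omega>)) = 0"
    by (auto simp: columns_E_mat)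
  then have c: "(\<Sum>j\<in>UNIV. w $ j * real (row_no j) ^ s * cos (real (row_no j) * \<omega>)) = 0"
    and s: "(\<Sum>j\<in>UNIV. w $ j * real (row_no j) ^ s * sin (real (row_no j) * \<omega>)) = 0"
    by (simp_all add: inner_vec_def mult.assoc)
  show "poly ((euler_op ^^ s) (vec_poly w)) (cis \<omega>) = 0"
    "poly ((euler_op ^^ s) (vec_poly w)) (cis (- \<omega>)) = 0"
    using c s unfolding poly_euler_op_vec_poly Complex.DeMoivre
    by (simp_all add: complex_eq_iff sum_negf mult.assoc del: of_nat_power
        flip: of_nat_power)
qed

lemma E_mat_subset_if_less_rho: "s < rho \<omega> L \<Longrightarrow> col_span (E_mat s \<omega>) \<subseteq> L"
  unfolding rho_def using not_less_Least by blast

lemma le_order_vec_poly: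
  fixes w :: "real^('n::{finite,linorder})"
  assumes "w \<noteq> 0" "\<And>s y. s < d \<Longrightarrow> y \<in> col_span (E_mat s \<omega>) \<Longrightarrow> w \<bullet> y = 0"
  shows "d \<le> order (cis \<omega>) (vec_poly w)" "d \<le> order (cis (- \<omega>)) (vec_poly w)"
  by (rule le_order_if_euler_op_zero;
      use assms in \<open>auto intro: euler_op_zero_if_perp_E_mat dest: vec_poly_nz\<close>)+

text \<open>The minimum in \<open>rho\<close> is attained: otherwise \<open>cis \<omega>\<close>
  would be a root of arbitrarily high multiplicity of a nonzero polynomial.\<close>

lemma E_mat_rho_not_subset:
  fixes w :: "real^('n::{finite,linorder})"
  assumes "w \<noteq> 0" "\<And>y. y \<in> L \<Longrightarrow> w \<bullet> y = 0"
  shows "\<not> col_span (E_mat (rho \<omega> L) \<omega>) \<subseteq> L"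
proof -
  have "\<exists>s. \<not> col_span (E_mat s \<omega>) \<subseteq> L"
  proof (rule ccontr)
    assume "\<not> ?thesis"
    then have "Suc (order (cis \<omega>) (vec_poly w)) \<le> order (cis \<omega>) (vec_poly w)"
      by (intro le_order_vec_poly(1)) (use assms in blast)+
    then show False by simp
  qed
  then show ?thesis unfolding rho_def by (rule LeastI_ex)
qed

section \<open>Counting roots on the unit circle\<close>

lemma cis_inj_on: "inj_on cis {0..pi}"
  by (rule inj_onI) (metis cos_inj_pi atLeastAtMost_iff cis.sel(1))

lemma sum_order_le_degree_superset:
  fixes p :: "complex poly"
  assumes "finite A" "p \<noteq> 0"
  shows "(\<Sum>z\<in>A. order z p) \<le> degree p"
proof -
  have "(\<Sum>z\<in>A. order z p) \<le> (\<Sum>z\<in>A \<union> {z. poly p z = 0}. order z p)"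
    by (rule sum_mono2) (use assms poly_roots_finite in auto)
  also have "\<dots> = (\<Sum>z | poly p z = 0. order z p)"
    by (rule sum.mono_neutral_right) (use assms poly_roots_finite order_0I[of p] in auto)
  finally show ?thesis using sum_order_le_degree[OF assms(2)] by simp
qed

text \<open>An interior frequency gives two conjugate roots of multiplicity at least
  \<open>d \<omega>\<close>, while at 0 and \<open>pi\<close> the two coincide; this is the case
  distinction in \<open>kappa\<close>.\<close>

lemma sum_kappa_less:
  fixes w :: "real^('n::{finite,linorder})"
  assumes "w \<noteq> 0" and \<Omega>: "finite \<Omega>" "\<Omega> \<subseteq> {0..pi}"
    and perp: "\<And>\<omega> s y. \<omega> \<in> \<Omega> \<Longrightarrow> s < d \<omega> \<Longrightarrow> y \<in> col_span (E_mat s \<omega>) \<Longrightarrow> w \<bullet> y = 0"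
  shows "(\<Sum>\<omega>\<in>\<Omega>. kappa \<omega> (d \<omega>)) < CARD('n)"
proof -
  let ?p = "vec_poly w"
  define \<Omega>' where "\<Omega>' = \<Omega> \<inter> {0<..<pi}"
  define Z where "Z = cis ` \<Omega>"
  define Z' where "Z' = (\<lambda>\<omega>. cis (- \<omega>)) ` \<Omega>'"
  have pnz: "?p \<noteq> 0" by (rule vec_poly_nz) fact
  have inj: "inj_on cis \<Omega>" using cis_inj_on \<Omega>(2) by (rule inj_on_subset)
  have "inj_on (\<lambda>\<omega>. cis (- \<omega>)) \<Omega>'"
    by (rule inj_onI)
      (metis \<Omega>'_def IntE \<Omega>(2) cis_cnj complex_cnj_cancel_iff inj inj_onD)
  note inj' = this
  \<comment> \<open>\<open>Z\<close> lies in the closed upper half plane, \<open>Z'\<close> in the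
    open lower one, so no root is counted twice.\<close>
  have disj: "Z \<inter> Z' = {}"
  proof -
    have "Im z \<ge> 0" if "z \<in> Z" for z
      using that \<Omega>(2) by (auto simp: Z_def intro!: sin_ge_zero)
    moreover have "Im z < 0" if "z \<in> Z'" for z
      using that by (auto simp: Z'_def \<Omega>'_def intro!: sin_gt_zero)
    ultimately show ?thesis by force
  qed
  have fin: "finite Z" "finite Z'" using \<Omega> by (auto simp: Z_def Z'_def \<Omega>'_def)
  have "(\<Sum>\<omega>\<in>\<Omega>. kappa \<omega> (d \<omega>)) = (\<Sum>\<omega>\<in>\<Omega>. d \<omega>) + (\<Sum>\<omega>\<in>\<Omega>'. d \<omega>)"
  proof -
    have "(\<Sum>\<omega>\<in>\<Omega>'. d \<omega>) = (\<Sum>\<omega>\<in>\<Omega>. if \<omega> \<in> {0<..<pi} then d \<omega> else 0)"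
      unfolding \<Omega>'_def by (rule sum.inter_restrict) (rule \<Omega>)
    then show ?thesis
      by (auto simp: kappa_def sum.distrib[symmetric] intro!: sum.cong)
  qed
  also have "\<dots> \<le> (\<Sum>\<omega>\<in>\<Omega>. order (cis \<omega>) ?p) + (\<Sum>\<omega>\<in>\<Omega>'. order (cis (- \<omega>)) ?p)"
    by (intro add_mono sum_mono le_order_vec_poly)
      (use assms in \<open>auto simp: \<Omega>'_def\<close>)
  also have "\<dots> = (\<Sum>z\<in>Z \<union> Z'. order z ?p)"
    using fin disj inj inj' unfolding Z_def Z'_def
    by (simp add: sum.union_disjoint sum.reindex o_def)
  finally have le: "(\<Sum>\<omega>\<in>\<Omega>. kappa \<omega> (d \<omega>)) \<le> (\<Sum>z\<in>Z \<union> Z'. order z ?p)" .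
  have zero: "0 ^ row_no j = (0::complex)" for j :: 'n using row_no_pos by (rule zero_power)
  have "poly ?p 0 = 0" unfolding poly_vec_poly zero by simp
  then have "order 0 ?p \<noteq> 0" using pnz order_root by blast
  \<comment> \<open>The root 0 lies off the unit circle and adds one to the count; hence the strict
    inequality.\<close>
  with le have "Suc (\<Sum>\<omega>\<in>\<Omega>. kappa \<omega> (d \<omega>)) \<le> order 0 ?p + (\<Sum>z\<in>Z \<union> Z'. order z ?p)"
    by linarith
  also have "\<dots> = (\<Sum>z\<in>insert 0 (Z \<union> Z'). order z ?p)"
    using fin by (subst sum.insert) (auto simp: Z_def Z'_def)
  also have "\<dots> \<le> degree ?p"
    using fin pnz by (intro sum_order_le_degree_superset) auto
  also have "\<dots> \<le> CARD('n)" by (rule degree_vec_poly)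
  finally show ?thesis by simp
qed

text \<open>Different frequencies of this set give different roots of \<open>vec_poly w\<close>.
  Finiteness keeps \<open>sorted_list_of_set\<close> from returning its default, the empty
  list.\<close>

lemma finite_rho_pos:
  fixes w :: "real^('n::{finite,linorder})"
  assumes "w \<noteq> 0" "\<And>y. y \<in> L \<Longrightarrow> w \<bullet> y = 0"
  shows "finite {\<omega>\<in>{0..pi}. 0 < rho \<omega> L}"
proof (rule finite_imageD)
  have "poly (vec_poly w) (cis \<omega>) = 0" if "0 < rho \<omega> L" for \<omega>
  proof -
    have "rho \<omega> L \<le> order (cis \<omega>) (vec_poly w)"
      by (rule le_order_vec_poly) (use assms E_mat_subset_if_less_rho in blast)+
    then show ?thesis using that by (simp add: order_root)
  qed
  then have "cis ` {\<omega>\<in>{0..pi}. 0 < rho \<omega> L} \<subseteq> {z. poly (vec_poly w) z = 0}" by auto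
  then show "finite (cis ` {\<omega>\<in>{0..pi}. 0 < rho \<omega> L})"
    using poly_roots_finite[OF vec_poly_nz[OF assms(1)]] finite_subset by blast
  show "inj_on cis {\<omega>\<in>{0..pi}. 0 < rho \<omega> L}"
    by (rule inj_on_subset[OF cis_inj_on]) auto
qed

lemma kappa_vec_eq_sum:
  assumes "finite {\<omega>\<in>{0..pi}. 0 < rho \<omega> L}"
  shows "kappa_vec (omega_vec L) (d_vec L) = (\<Sum>\<omega> \<in> {\<omega>\<in>{0..pi}. 0 < rho \<omega> L}. kappa \<omega> (rho \<omega> L))"
proof -
  have "kappa_vec xs (map f xs) = (\<Sum>\<omega>\<leftarrow>xs. kappa \<omega> (f \<omega>))" for xs f
    by (induction xs) (auto simp: kappa_vec_def)
  then show ?thesis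
    using assms by (simp add: d_vec_def omega_vec_def sum_list_distinct_conv_sum_set)
qed

lemma kappa_condition:
  fixes w :: "real^('n::{finite,linorder})" and L :: "(real^('n::{finite,linorder})) set"
  assumes "w \<noteq> 0" "\<gamma> \<in> {0..pi}"
    and "\<And>y. y \<in> L \<Longrightarrow> w \<bullet> y = 0"
    and "\<And>y. y \<in> col_span (E_mat (rho \<gamma> L) \<gamma>) \<Longrightarrow> w \<bullet> y = 0"
  shows "kappa_vec (omega_vec L) (d_vec L) + kappa \<gamma> 1 < CARD('n)"
proof -
  define \<Omega> where "\<Omega> = {\<omega>\<in>{0..pi}. 0 < rho \<omega> L}"
  have fin: "finite \<Omega>" unfolding \<Omega>_def using assms by (intro finite_rho_pos)
  \<comment> \<open>One more order at \<open>\<gamma>\<close>, because \<open>w\<close> is also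
    orthogonal to the columns of \<open>E_mat (rho \<gamma> L) \<gamma>\<close>; additivity of
    \<open>kappa\<close> turns it into the summand \<open>kappa \<gamma> 1\<close>.\<close>
  define d where "d \<omega> = rho \<omega> L + of_bool (\<omega> = \<gamma>)" for \<omega>
  have "(\<Sum>\<omega>\<in>insert \<gamma> \<Omega>. kappa \<omega> (d \<omega>)) < CARD('n)"
  proof (rule sum_kappa_less[of w])
    fix \<omega> s y
    assume *: "\<omega> \<in> insert \<gamma> \<Omega>" "s < d \<omega>" "y \<in> (col_span (E_mat s \<omega>) :: (real^('n::{finite,linorder})) set)"
    show "w \<bullet> y = 0"
    proof (cases "s < rho \<omega> L")
      case True
      then show ?thesis using *(3) assms(3) E_mat_subset_if_less_rho by blast
    next
      case False
      then have "\<omega> = \<gamma>" "s = rho \<omega> L" using *(2) by (auto simp: d_def of_bool_def split: if_splits)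
      then show ?thesis using * assms(4) by blast
    qed
  qed (use assms fin in \<open>auto simp: \<Omega>_def\<close>)
  moreover have "kappa \<omega> (d \<omega>) = kappa \<omega> (rho \<omega> L) + (if \<omega> = \<gamma> then kappa \<gamma> 1 else 0)" for \<omega>
    by (auto simp: kappa_def d_def)
  \<comment> \<open>If \<open>\<gamma>\<close> is not in \<open>\<Omega>\<close>, its
    \<open>rho\<close> is 0 and the added term vanishes.\<close>
  moreover have "(\<Sum>\<omega>\<in>insert \<gamma> \<Omega>. kappa \<omega> (rho \<omega> L)) = (\<Sum>\<omega>\<in>\<Omega>. kappa \<omega> (rho \<omega> L))"
    by (rule sum.mono_neutral_right) (use fin assms in \<open>auto simp: \<Omega>_def kappa_def\<close>)
  ultimately show ?thesis
    using fin unfolding kappa_vec_eq_sum[OF fin[unfolded \<Omega>_def]] \<Omega>_def[symmetric]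
    by (simp add: sum.distrib)
qed

section \<open>Matrices and Gaussian measures\<close>

text \<open>Gram-Schmidt for the scalar product \<open>u \<bullet> (A *v v)\<close>: a maximal
  orthonormal set is a basis, and with it as rows of \<open>U\<close> one has
  \<open>U ** A ** transpose U = mat 1\<close>. Then \<open>B = A ** transpose U\<close> is the
  inverse of \<open>U\<close>, and \<open>B ** transpose B = B ** U ** A = A\<close>.\<close>

lemma pos_definite_factorization:
  fixes A :: "real^'n^'n"
  assumes sym: "transpose A = A" and pd: "\<And>v. v \<noteq> 0 \<Longrightarrow> 0 < v \<bullet> (A *v v)"
  shows "\<exists>B :: real^'n^'n. B ** transpose B = A"
proof -
  define on where "on S \<longleftrightarrow> finite S \<and> (\<forall>u\<in>S. \<forall>v\<in>S. u \<bullet> (A *v v) = (if u = v then 1 else 0))"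
    for S :: "(real^'n) set"
  have comm: "u \<bullet> (A *v v) = v \<bullet> (A *v u)" for u v
    by (metis dot_lmul_matrix inner_commute sym transpose_matrix_vector)
  have expand: "(\<Sum>u\<in>S. c u *\<^sub>R u) \<bullet> (A *v v) = c v" if "on S" "v \<in> S" for S c v
  proof -
    have "(\<Sum>u\<in>S. c u *\<^sub>R u) \<bullet> (A *v v) = (\<Sum>u\<in>S. c u * (if u = v then 1 else 0))"
      using that by (auto simp: on_def inner_sum_left intro!: sum.cong)
    also have "\<dots> = c v" using that by (simp add: on_def if_distrib cong: if_cong)
    finally show ?thesis .
  qed
  have indep: "independent S" if "on S" for S
  proof (rule real_vector.independent_if_scalars_zero)
    show "finite S" using that by (simp add: on_def)
    show "c v = 0" if "(\<Sum>u\<in>S. c u *\<^sub>R u) = 0" "v \<in> S" for c v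
      using expand[OF \<open>on S\<close> that(2), of c] that(1) by simp
  qed
  have "\<exists>S. on S \<and> (\<forall>S'. on S' \<longrightarrow> card S' \<le> card S)"
  proof (rule Lattices_Big.ex_has_greatest_nat)
    show "on {}" by (simp add: on_def)
    show "\<forall>S'. on S' \<longrightarrow> card S' < Suc CARD('n)"
      using indep independent_card_le by fastforce
  qed
  then obtain S where S: "on S" and max: "\<And>S'. on S' \<Longrightarrow> card S' \<le> card S" by blast
  have fin: "finite S" using S by (simp add: on_def)
  have span: "span S = UNIV"
  proof (rule ccontr)
    assume "span S \<noteq> UNIV"
    then obtain v where v: "v \<notin> span S" by blast
    \<comment> \<open>The projection of \<open>v\<close> to \<open>span S\<close>, orthogonal for
      the new scalar product; the normalized remainder \<open>x\<close> would enlarge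
      \<open>S\<close>.\<close>
    define p where "p = (\<Sum>u\<in>S. (u \<bullet> (A *v v)) *\<^sub>R u)"
    have p: "p \<in> span S" unfolding p_def by (intro span_sum span_scale span_base)
    have perp: "(v - p) \<bullet> (A *v u) = 0" if "u \<in> S" for u
      unfolding p_def inner_diff_left expand[OF S that] by (simp add: comm[of v])
    have nz: "v - p \<noteq> 0" using v p by auto
    define c where "c = (v - p) \<bullet> (A *v (v - p))"
    have c: "0 < c" unfolding c_def by (rule pd[OF nz])
    define x where "x = (v - p) /\<^sub>R sqrt c"
    have "v = sqrt c *\<^sub>R x + p" using c by (simp add: x_def)
    then have xS: "x \<notin> span S" using v p span_add span_scale by metis
    have xu: "x \<bullet> (A *v u) = 0" if "u \<in> S" for u using perp[OF that] by (simp add: x_def)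
    then have ux: "u \<bullet> (A *v x) = 0" if "u \<in> S" for u using that comm by metis
    have xx: "x \<bullet> (A *v x) = 1"
      using c by (simp add: x_def matrix_vector_mult_scaleR flip: c_def)
        (simp add: field_simps)
    have "x \<notin> S" using xS span_base by blast
    then have "on (insert x S)"
      using S xu ux xx unfolding on_def by (intro conjI ballI) (auto split: if_splits)
    from max[OF this] show False using \<open>x \<notin> S\<close> fin by simp
  qed
  have "card S = CARD('n)"
    using dim_unique[OF _ _ indep[OF S] refl, of UNIV] span by simp
  then obtain h where h: "bij_betw h (UNIV :: 'n set) S"
    using fin by (metis finite_class.finite_UNIV finite_same_card_bij)
  define U :: "real^'n^'n" where "U = (\<chi> i. h i)"
  define B where "B = A ** transpose U"
  have hS: "h i \<in> S" for i using h by (auto simp: bij_betw_def)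
  have "(U ** B) $ i $ j = h i \<bullet> (A *v h j)" for i j
    unfolding B_def U_def matrix_matrix_mult_def matrix_vector_mult_def transpose_def
    by (simp add: inner_vec_def)
  also have "\<dots> i j = (if i = j then 1 else 0)" for i j
    using S hS[of i] hS[of j] bij_betw_imp_inj_on[OF h] by (auto simp: on_def inj_eq)
  finally have "U ** B = mat 1" by (simp add: vec_eq_iff mat_def)
  then have BU: "B ** U = mat 1" by (simp add: matrix_left_right_inverse)
  have "B ** transpose B = B ** U ** A"
    unfolding B_def by (simp add: matrix_transpose_mul sym matrix_mul_assoc)
  then show ?thesis using BU by auto
qed

section \<open>The standard Gaussian measure and its affine images\<close>

lemma sets_std_gaussian [measurable_cong, simp]: "sets std_gaussian = sets borel"
  by (simp add: std_gaussian_def)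

lemma space_std_gaussian [simp]: "space std_gaussian = UNIV"
  by (simp add: std_gaussian_def)

lemma prob_space_std_gaussian: "prob_space (std_gaussian :: (real^'n) measure)"
proof
  have "emeasure (std_gaussian :: (real^'n) measure) UNIV =
      (\<integral>\<^sup>+ z. ennreal (\<Prod>i\<in>UNIV. std_normal_density (z $ i)) \<partial>(lborel :: (real^'n) measure))"
    unfolding std_gaussian_def by (subst emeasure_density) (simp_all add: nn_integral_density)
  also have "\<dots> = (\<integral>\<^sup>+ z. (\<Prod>b\<in>Basis. ennreal (std_normal_density (z \<bullet> b))) \<partial>(lborel :: (real^'n) measure))"
  proof (intro nn_integral_cong)
    fix z :: "real^'n"
    have B: "Basis = (\<lambda>i. axis i (1::real)) ` (UNIV :: 'n set)" by (auto simp: Basis_vec_def)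
    have inj: "inj (\<lambda>i :: 'n. axis i (1::real))" by (auto simp: inj_def axis_eq_axis)
    show "ennreal (\<Prod>i\<in>UNIV. std_normal_density (z $ i)) =
        (\<Prod>b\<in>Basis. ennreal (std_normal_density (z \<bullet> b)))"
      unfolding B by (simp add: prod.reindex[OF inj] prod_ennreal inner_axis)
  qed
  also have "\<dots> = (\<Prod>b\<in>(Basis :: (real^'n) set). \<integral>\<^sup>+ x. ennreal (std_normal_density x) \<partial>lborel)"
    by (rule nn_integral_lborel_prod) simp_all
  also have "(\<integral>\<^sup>+ x. ennreal (std_normal_density x) \<partial>lborel) = 1"
    using prob_space.emeasure_space_1[OF prob_space_normal_density[of 1 0]]
    by (simp add: emeasure_density)
  finally show "emeasure (std_gaussian :: (real^'n) measure) (space std_gaussian) = 1" by simp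
qed

lemma AE_std_gaussian:
  assumes "AE z in lborel. P z"
  shows "AE z in (std_gaussian :: (real^'n) measure). P z"
  unfolding std_gaussian_def using assms by (subst AE_density) auto

lemma AE_std_gaussian_negligible:
  fixes S :: "(real^'n) set"
  assumes "negligible S"
  shows "AE z in std_gaussian. z \<notin> S"
proof (rule AE_std_gaussian)
  have "AE z in lebesgue. z \<notin> S"
    using assms AE_not_in by (auto simp: negligible_iff_null_sets)
  then show "AE z in lborel. z \<notin> S" by (simp add: AE_completion_iff)
qed

lemma measurable_affine [measurable]:
  "(\<lambda>z. \<mu> + (B :: real^'n^'m) *v z) \<in> borel_measurable borel"
  by (intro borel_measurable_continuous_onI continuous_intros)

lemma measure_gaussian_measure:
  assumes "S \<in> sets borel"
  shows "measure (gaussian_measure \<mu> A) S =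
     measure std_gaussian {z. \<mu> + (SOME B :: real^'n^'n. B ** transpose B = A) *v z \<in> S}"
  unfolding gaussian_measure_def
  by (subst measure_distr) (use assms in \<open>auto simp: vimage_def\<close>)

text \<open>The preimage of \<open>S\<close> is its image under the inverse affine map, which
  preserves negligible sets; the Gaussian law is absolutely continuous.\<close>

lemma AE_affine_notin_negligible:
  fixes S :: "(real^'n) set" and B :: "real^'n^'n"
  assumes "negligible S" "invertible B"
  shows "AE z in std_gaussian. \<mu> + B *v z \<notin> S"
proof -
  obtain C where C: "C ** B = mat 1" using assms(2) by (auto simp: invertible_def)
  have lin: "(\<lambda>y. C *v (y - \<mu>)) differentiable_on S"
    by (rule differentiable_on_compose[of "\<lambda>y. y - \<mu>" _ "(*v) C"])
      (simp_all add: linear_imp_differentiable_on)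
  have "negligible ((\<lambda>y. C *v (y - \<mu>)) ` S)"
    by (rule negligible_differentiable_image_negligible[OF _ assms(1) lin]) simp
  from AE_std_gaussian_negligible[OF this] show ?thesis
  proof eventually_elim
    case (elim z)
    have "z = C *v ((\<mu> + B *v z) - \<mu>)" by (simp add: matrix_vector_mul_assoc C)
    with elim show ?case by blast
  qed
qed

lemma (in prob_space) prob_tendsto_1_if_AE_eventually:
  assumes "\<And>m. S m \<in> sets M" "AE z in M. eventually (\<lambda>m. z \<in> S m) sequentially"
  shows "(\<lambda>m. prob (S m)) \<longlonglongrightarrow> 1"
proof -
  have "(\<lambda>m. \<integral>z. indicator (S m) z \<partial>M) \<longlonglongrightarrow> (\<integral>z. 1 \<partial>M :: real)"
  proof (rule integral_dominated_convergence[where w="\<lambda>_. 1"])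
    show "AE z in M. (\<lambda>m. indicator (S m) z :: real) \<longlonglongrightarrow> 1"
      using assms(2)
    proof eventually_elim
      case (elim z)
      then have "eventually (\<lambda>m. indicator (S m) z = (1::real)) sequentially"
        by eventually_elim simp
      then show ?case by (rule tendsto_eventually)
    qed
  qed (use assms(1) in \<open>auto simp: indicator_def\<close>)
  then show ?thesis using assms(1) by (simp add: prob_space)
qed

section \<open>Inverse matrices, quadratic forms and measurability of the statistic\<close>

lemma invertible_matrix_inv:
  fixes A :: "real^'n^'n"
  assumes "invertible A"
  shows "A ** matrix_inv A = mat 1"
  using assms unfolding invertible_def matrix_inv_def by (rule someI2_ex) blast

text \<open>Cramer's rule replaces \<open>matrix_inv\<close>, which is defined by choice, by
  quotients of determinants, whose measurability is clear.\<close>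

lemma matrix_inv_vec_cramer:
  fixes A :: "real^'n^'n"
  assumes "det A \<noteq> 0"
  shows "matrix_inv A *v b = (\<chi> k. det (\<chi> i j. if j = k then b $ i else A $ i $ j) / det A)"
  using assms cramer[OF assms, of "matrix_inv A *v b" b]
  by (simp add: matrix_vector_mul_assoc invertible_matrix_inv invertible_det_nz)

lemma continuous_on_det:
  fixes A :: "'a::topological_space \<Rightarrow> real^'n^'n"
  assumes "\<And>i j. continuous_on S (\<lambda>y. A y $ i $ j)"
  shows "continuous_on S (\<lambda>y. det (A y))"
  unfolding det_def by (intro continuous_intros assms)

lemma continuous_on_matrix_vector [continuous_intros]:
  "continuous_on S g \<Longrightarrow> continuous_on S (\<lambda>y. (A :: real^'n^'m) *v g y)"
  by (rule bounded_linear.continuous_on[OF matrix_vector_mul_bounded_linear])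

lemma F_type_stat_measurable:
  assumes bc: "continuous_on UNIV bc" and Oc: "continuous_on UNIV Oc"
  shows "F_type_stat R r bc Oc {} \<in> borel_measurable borel"
proof -
  let ?v = "\<lambda>y. R *v bc y - r"
  let ?D = "\<lambda>y k. det (\<chi> i j. if j = k then ?v y $ i else Oc y $ i $ j)"
  have v: "continuous_on UNIV ?v"
    by (intro continuous_intros bc)
  have Ocij: "continuous_on UNIV (\<lambda>y. Oc y $ i $ j)" for i j
    by (intro continuous_intros Oc)
  have [measurable]: "(\<lambda>y. det (Oc y)) \<in> borel_measurable borel"
    by (intro borel_measurable_continuous_onI continuous_on_det Ocij)
  have [measurable]: "(\<lambda>y. ?D y k) \<in> borel_measurable borel" for k
  proof (intro borel_measurable_continuous_onI continuous_on_det)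
    fix i j show "continuous_on UNIV (\<lambda>y. (\<chi> i j. if j = k then ?v y $ i else Oc y $ i $ j) $ i $ j)"
      using v Ocij by (cases "j = k") (auto intro!: continuous_intros bc)
  qed
  have [measurable]: "(\<lambda>y. ?v y $ k) \<in> borel_measurable borel" for k
    by (intro borel_measurable_continuous_onI continuous_intros bc)
  \<comment> \<open>With \<open>N\<close> empty, \<open>N_star\<close> is the zero set of the
    determinant, where the statistic has its default value 0.\<close>
  have "F_type_stat R r bc Oc {} =
      (\<lambda>y. if det (Oc y) = 0 then 0 else \<Sum>k\<in>UNIV. ?v y $ k * (?D y k / det (Oc y)))"
    by (rule ext) (simp add: F_type_stat_def N_star_def matrix_inv_vec_cramer inner_vec_def)
  then show ?thesis by (simp only:) measurable
qed

text \<open>For symmetric nonnegative definite \<open>A\<close> and \<open>x = A\<^sup>-\<^sup>1 v\<close>, expand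
  \<open>0 \<le> (x - t v)' A (x - t v)\<close> with \<open>t = 1 / K\<close>.\<close>
lemma quadratic_form_inv_lower_bound:
  fixes A :: "real^'q^'q"
  assumes sym: "transpose A = A" and nnd: "nonneg_definite A" and inv: "invertible A"
    and K: "0 < K" "v \<bullet> (A *v v) \<le> K * (v \<bullet> v)"
  shows "(v \<bullet> v) / K \<le> v \<bullet> (matrix_inv A *v v)"
proof -
  define x where "x = matrix_inv A *v v"
  define t where "t = 1 / K"
  have Ax: "A *v x = v" by (simp add: x_def matrix_vector_mul_assoc invertible_matrix_inv inv)
  have xAv: "x \<bullet> (A *v v) = v \<bullet> v"
    by (metis Ax dot_lmul_matrix sym transpose_matrix_vector)
  have "0 \<le> (x - t *\<^sub>R v) \<bullet> (A *v (x - t *\<^sub>R v))"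
    using nnd by (simp add: nonneg_definite_def)
  also have "\<dots> = v \<bullet> x - 2 * t * (v \<bullet> v) + t * (t * (v \<bullet> (A *v v)))"
    by (simp add: matrix_vector_mult_diff_distrib matrix_vector_mult_scaleR Ax xAv
        inner_diff_left inner_diff_right inner_commute algebra_simps)
  also have "t * (t * (v \<bullet> (A *v v))) \<le> t * (t * (K * (v \<bullet> v)))"
    using K by (intro mult_left_mono) (auto simp: t_def)
  also have "v \<bullet> x - 2 * t * (v \<bullet> v) + t * (t * (K * (v \<bullet> v))) = v \<bullet> x - (v \<bullet> v) / K"
    using K by (simp add: t_def)
  finally show ?thesis by (simp add: x_def)
qed

lemma quadratic_form_le_sum_abs:
  fixes A :: "real^'q^'q"
  shows "v \<bullet> (A *v v) \<le> (\<Sum>i\<in>UNIV. \<Sum>j\<in>UNIV. \<bar>A $ i $ j\<bar>) * (v \<bullet> v)"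
proof -
  have "v \<bullet> (A *v v) = (\<Sum>i\<in>UNIV. \<Sum>j\<in>UNIV. A $ i $ j * (v $ i * v $ j))"
    by (simp add: inner_vec_def matrix_vector_mult_def sum_distrib_left mult_ac)
  also have "\<dots> \<le> (\<Sum>i\<in>UNIV. \<Sum>j\<in>UNIV. \<bar>A $ i $ j\<bar> * (v \<bullet> v))"
  proof (intro sum_mono)
    fix i j
    have "\<bar>v $ i * v $ j\<bar> \<le> norm v * norm v"
      unfolding abs_mult by (intro mult_mono component_le_norm_cart) auto
    then have "\<bar>A $ i $ j * (v $ i * v $ j)\<bar> \<le> \<bar>A $ i $ j\<bar> * (v \<bullet> v)"
      by (simp add: abs_mult[of "A $ i $ j"] mult_left_mono power2_norm_eq_inner[symmetric] power2_eq_square)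
    then show "A $ i $ j * (v $ i * v $ j) \<le> \<bar>A $ i $ j\<bar> * (v \<bullet> v)" by linarith
  qed
  finally show ?thesis by (simp add: sum_distrib_right)
qed

text \<open>The identity minus a linear projection onto \<open>L\<close>. Applying it amounts to
  computing modulo \<open>L\<close>.\<close>

lemma exists_projection:
  fixes L :: "(real^'n) set"
  assumes "subspace L"
  shows "\<exists>P :: real^'n^'n. (\<forall>y\<in>L. P *v y = 0) \<and> (\<forall>y. y - P *v y \<in> L)"
proof -
  obtain g where g: "g ` UNIV \<subseteq> L" "linear g" "\<And>v. v \<in> L \<Longrightarrow> g v = v"
    using real_vector.linear_exists_left_inverse_on[of id L] assms linear_id by auto
  have "linear (\<lambda>y. y - g y)" by (intro linear_compose_sub linear_ident g(2))
  then show ?thesis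
    using g by (intro exI[of _ "matrix (\<lambda>y. y - g y)"]) auto
qed

section \<open>Autoregressive spectral densities near the unit circle\<close>

text \<open>The polynomial 1 - a z - b z^2 with \<open>a = 2 * s * cos \<theta>\<close> and
  \<open>b = - s\<^sup>2\<close>. For 0 < s < 1 its roots
  \<open>cis (\<plusminus> \<theta>) / s\<close> lie outside the unit circle; they approach it as s
  tends to 1.\<close>

definition ar2_char :: "real \<Rightarrow> real \<Rightarrow> complex \<Rightarrow> complex" where
  "ar2_char s \<theta> z = 1 - of_real (2 * s * cos \<theta>) * z + of_real (s\<^sup>2) * z\<^sup>2"

lemma ar2_char_factor:
  "ar2_char s \<theta> z = (1 - of_real s * cis \<theta> * z) * (1 - of_real s * cis (- \<theta>) * z)"
proof -
  have "cis \<theta> + cis (- \<theta>) = of_real (2 * cos \<theta>)" by (simp add: complex_eq_iff)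
  moreover have "cis \<theta> * cis (- \<theta>) = 1" by (simp add: cis_mult)
  moreover have "(1 - of_real s * cis \<theta> * z) * (1 - of_real s * cis (- \<theta>) * z) =
      1 - of_real s * (cis \<theta> + cis (- \<theta>)) * z + (of_real s)\<^sup>2 * (cis \<theta> * cis (- \<theta>)) * z\<^sup>2"
    by algebra
  ultimately show ?thesis by (simp add: ar2_char_def)
qed

lemma ar2_char_nz:
  assumes "\<bar>s\<bar> * norm z < 1"
  shows "ar2_char s \<theta> z \<noteq> 0"
proof -
  have "norm (of_real s * cis t * z) < 1" for t using assms by (simp add: norm_mult)
  then have "1 - of_real s * cis t * z \<noteq> 0" for t
    by (metis less_irrefl norm_one right_minus_eq)
  then show ?thesis by (simp add: ar2_char_factor)
qed

lemma cnj_ar2_char: "cnj (ar2_char s \<theta> z) = ar2_char s \<theta> (cnj z)"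
  by (simp add: ar2_char_def)

definition ar2_kernel :: "real \<Rightarrow> real \<Rightarrow> real \<Rightarrow> real" where
  "ar2_kernel s \<theta> \<omega> = 1 / (norm (ar2_char s \<theta> (cis \<omega>)))\<^sup>2"

context
  fixes s \<theta> :: real
  assumes s: "0 < s" "s < 1"
begin

lemma ar2_char_cis_nz: "ar2_char s \<theta> (cis \<omega>) \<noteq> 0"
  by (rule ar2_char_nz) (use s in simp)

lemma ar2_kernel_pos: "0 < ar2_kernel s \<theta> \<omega>"
  using ar2_char_cis_nz by (simp add: ar2_kernel_def)

lemma ar2_kernel_even: "ar2_kernel s \<theta> (- \<omega>) = ar2_kernel s \<theta> \<omega>"
  unfolding ar2_kernel_def by (metis cis_cnj cnj_ar2_char complex_mod_cnj)

lemma continuous_on_ar2_kernel [continuous_intros]: "continuous_on S (ar2_kernel s \<theta>)"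
proof -
  have "continuous_on S (\<lambda>\<omega>. ar2_char s \<theta> (cis \<omega>))"
    unfolding ar2_char_def by (intro continuous_intros)
  then show ?thesis
    unfolding ar2_kernel_def using ar2_char_cis_nz by (intro continuous_intros) auto
qed

text \<open>Division by \<open>ar2_char\<close> is multiplication by its conjugate and by
  \<open>ar2_kernel\<close>. On the unit circle conjugation is inversion, so the conjugate lowers
  the power m by 0, 1 and 2.\<close>

lemma ar2_kernel_recursion_identity:
  assumes "1 \<le> m"
  shows "Re (cis \<omega> ^ m / ar2_char s \<theta> (cis \<omega>)) =
     (cos (real m * \<omega>) - 2 * s * cos \<theta> * cos ((real m - 1) * \<omega>) +
      s\<^sup>2 * cos ((real m - 2) * \<omega>)) * ar2_kernel s \<theta> \<omega>"
proof -
  have "cis \<omega> ^ m / ar2_char s \<theta> (cis \<omega>) =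
      cis \<omega> ^ m * cnj (ar2_char s \<theta> (cis \<omega>)) / of_real ((norm (ar2_char s \<theta> (cis \<omega>)))\<^sup>2)"
    by (rule complex_div_cnj[THEN trans]) simp
  also have "cis \<omega> ^ m * cnj (ar2_char s \<theta> (cis \<omega>)) =
      cis (real m * \<omega>) - of_real (2 * s * cos \<theta>) * cis ((real m - 1) * \<omega>)
        + of_real (s\<^sup>2) * cis ((real m - 2) * \<omega>)"
    unfolding cnj_ar2_char ar2_char_def cis_cnj[symmetric] Complex.DeMoivre
    by (simp add: cis_cnj algebra_simps cis_mult power2_eq_square)
  finally show ?thesis by (simp add: ar2_kernel_def)
qed

text \<open>As a function of \<open>cis \<omega>\<close>, the quotient in the preceding identity is holomorphic on the disc of
  radius \<open>1 / s > 1\<close> and vanishes at \<open>0\<close>, so its mean over the unit circle is \<open>0\<close>.\<close>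
lemma ar2_kernel_recursion:
  assumes "1 \<le> m"
  shows "((\<lambda>\<omega>. (cos (real m * \<omega>) - 2 * s * cos \<theta> * cos ((real m - 1) * \<omega>) +
      s\<^sup>2 * cos ((real m - 2) * \<omega>)) * ar2_kernel s \<theta> \<omega>) has_integral 0) {-pi..pi}"
proof -
  \<comment> \<open>The exponent is one lower because dz on the circle contributes
    \<open>\<i> * cis t\<close>; the factor \<open>\<i>\<close> is removed below by multiplying with
    \<open>- \<i>\<close>.\<close>
  let ?F = "\<lambda>z. z ^ (m - 1) / ar2_char s \<theta> z"
  have "(?F has_contour_integral 0) (part_circlepath 0 1 (-pi) pi)"
  proof (rule Cauchy_theorem_convex_simple)
    show "?F holomorphic_on ball 0 (1 / s)"
    proof (intro holomorphic_intros)
      show "ar2_char s \<theta> holomorphic_on ball 0 (1 / s)"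
        unfolding ar2_char_def by (intro holomorphic_intros)
      show "ar2_char s \<theta> z \<noteq> 0" if "z \<in> ball 0 (1 / s)" for z
        using that s by (intro ar2_char_nz) (simp add: field_simps)
    qed
    show "path_image (part_circlepath 0 1 (-pi) pi) \<subseteq> ball 0 (1 / s)"
      using path_image_part_circlepath_subset'[of 1 0 "-pi" pi] s
      by (auto simp: subset_iff dist_norm)
  qed (auto simp: exp_minus)
  then have "((\<lambda>t. ?F (0 + complex_of_real 1 * cis t) * complex_of_real 1 * \<i> * cis t) has_integral 0) {-pi..pi}"
    by (subst (asm) has_contour_integral_part_circlepath_iff) auto
  then have "((\<lambda>t. - \<i> * (?F (0 + complex_of_real 1 * cis t) * complex_of_real 1 * \<i> * cis t)) has_integral - \<i> * 0) {-pi..pi}"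
    by (rule has_integral_mult_right)
  moreover have "- \<i> * (?F (0 + complex_of_real 1 * cis t) * complex_of_real 1 * \<i> * cis t) =
      cis t ^ m / ar2_char s \<theta> (cis t)" for t
    using assms by (simp add: field_simps flip: power_Suc)
  ultimately have "((\<lambda>t. cis t ^ m / ar2_char s \<theta> (cis t)) has_integral 0) {-pi..pi}" by simp
  from has_integral_linear[OF this bounded_linear_Re] show ?thesis
    by (simp add: o_def ar2_kernel_recursion_identity[OF assms])
qed

text \<open>The autocovariance before normalization; the sine part drops out because the kernel is
  even.\<close>

definition ar2_cov :: "real \<Rightarrow> real" where
  "ar2_cov t = integral {-pi..pi} (\<lambda>\<omega>. cos (t * \<omega>) * ar2_kernel s \<theta> \<omega>)"

lemma ar2_cov_integral:
  "((\<lambda>\<omega>. cos (t * \<omega>) * ar2_kernel s \<theta> \<omega>) has_integral ar2_cov t) {-pi..pi}"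
  unfolding ar2_cov_def
  by (intro integrable_integral integrable_continuous_real continuous_intros)

lemma ar2_cov_minus: "ar2_cov (- t) = ar2_cov t"
  by (simp add: ar2_cov_def)

text \<open>Integrate the recursion of the kernel. At m = 1 the lag -1 enters, which by symmetry
  fixes the ratio of the first two autocovariances.\<close>

lemma yule_walker:
  assumes "1 \<le> m"
  shows "ar2_cov (real m) = 2 * s * cos \<theta> * ar2_cov (real m - 1) - s\<^sup>2 * ar2_cov (real m - 2)"
proof -
  have cov: "((\<lambda>\<omega>. cos (real m * \<omega>) * ar2_kernel s \<theta> \<omega>
       - 2 * s * cos \<theta> * (cos ((real m - 1) * \<omega>) * ar2_kernel s \<theta> \<omega>)
       + s\<^sup>2 * (cos ((real m - 2) * \<omega>) * ar2_kernel s \<theta> \<omega>)) has_integral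
      ar2_cov (real m) - 2 * s * cos \<theta> * ar2_cov (real m - 1) + s\<^sup>2 * ar2_cov (real m - 2)) {-pi..pi}"
    by (intro has_integral_add has_integral_diff has_integral_mult_right ar2_cov_integral)
  have zero: "((\<lambda>\<omega>. cos (real m * \<omega>) * ar2_kernel s \<theta> \<omega>
       - 2 * s * cos \<theta> * (cos ((real m - 1) * \<omega>) * ar2_kernel s \<theta> \<omega>)
       + s\<^sup>2 * (cos ((real m - 2) * \<omega>) * ar2_kernel s \<theta> \<omega>)) has_integral 0) {-pi..pi}"
    using ar2_kernel_recursion[OF assms] by (simp add: algebra_simps)
  show ?thesis using has_integral_unique[OF cov zero] by linarith
qed

lemma ar2_cov_0_pos: "0 < ar2_cov 0"
proof -
  have "ar2_cov 0 = integral {-pi..pi} (ar2_kernel s \<theta>)" by (simp add: ar2_cov_def)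
  moreover have "0 \<le> integral {-pi..pi} (ar2_kernel s \<theta>)"
    by (intro integral_nonneg integrable_continuous_real continuous_intros)
      (use ar2_kernel_pos less_imp_le in blast)
  moreover have "integral {-pi..pi} (ar2_kernel s \<theta>) \<noteq> 0"
  proof
    assume "integral {-pi..pi} (ar2_kernel s \<theta>) = 0"
    moreover have "(integral {-pi..pi} (ar2_kernel s \<theta>) = 0) = (\<forall>x\<in>{-pi..pi}. ar2_kernel s \<theta> x = 0)"
      by (intro integral_eq_0_iff continuous_intros)
        (use ar2_kernel_pos less_imp_le pi_gt_zero in \<open>auto intro: less_trans[of _ 0]\<close>)
    ultimately have "ar2_kernel s \<theta> 0 = 0" by auto
    then show False using ar2_kernel_pos[of 0] by simp
  qed
  ultimately show ?thesis by linarith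
qed

definition ar2_density :: "real \<Rightarrow> real" where
  "ar2_density \<omega> = (if \<omega> \<in> {-pi..pi} then ar2_kernel s \<theta> \<omega> / ar2_cov 0 else 0)"

lemma ar2_density_in_spec_AR2: "ar2_density \<in> spec_AR2"
proof -
  let ?q = "\<lambda>\<omega>. ar2_kernel s \<theta> \<omega> / ar2_cov 0"
  have cont: "continuous_on {-pi..pi} ?q"
    by (intro continuous_intros) (use ar2_cov_0_pos in auto)
  have q: "?q absolutely_integrable_on {-pi..pi}"
    by (rule absolutely_integrable_continuous_real[OF cont])
  have eq: "indicator {-pi..pi} \<omega> *\<^sub>R ar2_density \<omega> = indicator {-pi..pi} \<omega> *\<^sub>R ?q \<omega>" for \<omega>
    by (simp add: ar2_density_def indicator_def)
  have "(?q has_integral 1) {-pi..pi}"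
    using has_integral_divide[OF ar2_cov_integral[of 0], of "ar2_cov 0"] ar2_cov_0_pos by simp
  then have "(LINT \<omega>:{-pi..pi}|lebesgue. ?q \<omega>) = 1"
    unfolding set_lebesgue_integral_eq_integral(2)[OF q] by (rule integral_unique)
  then have int: "(LINT \<omega>:{-pi..pi}|lebesgue. ar2_density \<omega>) = 1"
    unfolding set_lebesgue_integral_def eq .
  have "set_integrable lebesgue {-pi..pi} ar2_density"
    using q unfolding set_integrable_def eq .
  moreover have "0 \<le> ar2_density \<omega>" "ar2_density (- \<omega>) = ar2_density \<omega>"
    "\<omega> \<notin> {-pi..pi} \<Longrightarrow> ar2_density \<omega> = 0" for \<omega>
    using ar2_kernel_pos ar2_cov_0_pos by (auto simp: ar2_density_def ar2_kernel_even less_imp_le)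
  ultimately have all: "ar2_density \<in> spec_all"
    using int unfolding spec_all_def by blast
  \<comment> \<open>The witnesses are \<open>a = 2 * s * cos \<theta>\<close>,
    \<open>b = - s\<^sup>2\<close> and \<open>c = 1 / ar2_cov 0\<close>. \<open>spec_AR2\<close>
    evaluates at \<open>cis (- \<omega>)\<close>, the kernel at \<open>cis \<omega>\<close>;
    evenness reconciles them.\<close>
  have "ar2_density \<omega> = (1 / ar2_cov 0) /
      (norm (1 - of_real (2 * s * cos \<theta>) * exp (- \<i> * of_real \<omega>)
                      - of_real (- (s\<^sup>2)) * exp (- 2 * \<i> * of_real \<omega>))) ^ 2"
    if "\<omega> \<in> {-pi..pi}" for \<omega>
  proof -
    have "exp (- 2 * \<i> * of_real \<omega>) = (exp (- \<i> * of_real \<omega>))\<^sup>2"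
      by (simp add: exp_double[symmetric] mult.assoc)
    moreover have "exp (- \<i> * of_real \<omega>) = cis (- \<omega>)" by (simp add: cis_conv_exp)
    ultimately have "ar2_kernel s \<theta> \<omega> = 1 / (norm (1 - of_real (2 * s * cos \<theta>) * exp (- \<i> * of_real \<omega>)
                      - of_real (- (s\<^sup>2)) * exp (- 2 * \<i> * of_real \<omega>))) ^ 2"
      using ar2_kernel_even[of \<omega>] by (simp add: ar2_kernel_def[of _ _ "- \<omega>"] ar2_char_def)
    then show ?thesis using that by (simp add: ar2_density_def)
  qed
  moreover have "1 - of_real (2 * s * cos \<theta>) * z - of_real (- (s\<^sup>2)) * z ^ 2 \<noteq> 0"
    if "norm z \<le> 1" for z :: complex
  proof -
    have "\<bar>s\<bar> * norm z < 1" using s that mult_left_le[of "norm z" s] by linarith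
    then show ?thesis using ar2_char_nz[of s z \<theta>] by (simp add: ar2_char_def)
  qed
  moreover have "0 < 1 / ar2_cov 0" using ar2_cov_0_pos by simp
  ultimately show ?thesis using all unfolding spec_AR2_def by blast
qed

lemma Sigma_mat_ar2:
  "(Sigma_mat ar2_density :: real^('n::{finite,linorder})^('n::{finite,linorder})) $ j $ l =
     ar2_cov (real (row_no j) - real (row_no l)) / ar2_cov 0"
proof -
  let ?t = "real (row_no j) - real (row_no l)"
  let ?h = "\<lambda>\<omega>. exp (- \<i> * of_real (?t * \<omega>)) * of_real (ar2_kernel s \<theta> \<omega> / ar2_cov 0)"
  have h: "?h absolutely_integrable_on {-pi..pi}"
    by (rule absolutely_integrable_continuous_real)
      (intro continuous_intros, use ar2_cov_0_pos in auto)
  have Re_eq: "Re (exp (- \<i> * of_real x) * of_real y) = cos x * y" for x y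
    by (simp add: Re_exp)
  have "(LINT \<omega>:{-pi..pi}|lebesgue. exp (- \<i> * of_real (?t * \<omega>)) * of_real (ar2_density \<omega>)) =
      (LINT \<omega>:{-pi..pi}|lebesgue. ?h \<omega>)"
    unfolding set_lebesgue_integral_def
    by (rule Bochner_Integration.integral_cong) (auto simp: ar2_density_def indicator_def)
  then have lint: "(LINT \<omega>:{-pi..pi}|lebesgue. exp (- \<i> * of_real (?t * \<omega>)) * of_real (ar2_density \<omega>)) =
      integral {-pi..pi} ?h"
    by (rule trans) (rule set_lebesgue_integral_eq_integral(2)[OF h])
  have Re_integral: "Re (integral {-pi..pi} ?h) = integral {-pi..pi} (Re \<circ> ?h)"
    by (rule integral_linear[OF set_lebesgue_integral_eq_integral(1)[OF h] bounded_linear_Re, symmetric])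
  have Re_h: "Re \<circ> ?h = (\<lambda>\<omega>. cos (?t * \<omega>) * ar2_kernel s \<theta> \<omega> / ar2_cov 0)"
    by (simp only: fun_eq_iff o_def Re_eq times_divide_eq_right simp_thms)
  have cov: "integral {-pi..pi} (\<lambda>\<omega>. cos (?t * \<omega>) * ar2_kernel s \<theta> \<omega> / ar2_cov 0) = ar2_cov ?t / ar2_cov 0"
    using has_integral_divide[OF ar2_cov_integral] by (rule integral_unique)
  show ?thesis
    by (simp only: Sigma_mat_def vec_lambda_beta lint Re_integral Re_h cov)
qed

text \<open>The quadratic form is the integral of the squared modulus of \<open>vec_poly w\<close>
  on the unit circle against the density. If it were 0, a nonzero polynomial would vanish on a whole
  arc.\<close>

lemma Sigma_mat_ar2_pos_definite:
  fixes w :: "real^('n::{finite,linorder})"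
  assumes "w \<noteq> 0"
  shows "0 < w \<bullet> (Sigma_mat ar2_density *v w)"
proof -
  let ?q = "\<lambda>\<omega>. (norm (poly (vec_poly w) (cis \<omega>)))\<^sup>2 * ar2_kernel s \<theta> \<omega>"
  have norm_eq: "(norm (poly (vec_poly w) (cis \<omega>)))\<^sup>2 =
      (\<Sum>j\<in>UNIV. \<Sum>l\<in>UNIV. w $ j * w $ l * cos ((real (row_no j) - real (row_no l)) * \<omega>))" for \<omega>
  proof -
    have "poly (vec_poly w) (cis \<omega>) = (\<Sum>j\<in>UNIV. of_real (w $ j) * cis (real (row_no j) * \<omega>))"
      by (simp add: poly_vec_poly Complex.DeMoivre)
    then have "(norm (poly (vec_poly w) (cis \<omega>)))\<^sup>2 =
        (\<Sum>j\<in>UNIV. w $ j * cos (real (row_no j) * \<omega>))\<^sup>2 + (\<Sum>j\<in>UNIV. w $ j * sin (real (row_no j) * \<omega>))\<^sup>2"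
      by (simp add: cmod_power2)
    then show ?thesis
      by (simp add: power2_eq_square sum_product left_diff_distrib cos_diff algebra_simps sum.distrib)
  qed
  have "((\<lambda>\<omega>. \<Sum>j\<in>UNIV. \<Sum>l\<in>UNIV. w $ j * w $ l *
       (cos ((real (row_no j) - real (row_no l)) * \<omega>) * ar2_kernel s \<theta> \<omega>)) has_integral
      (\<Sum>j\<in>UNIV. \<Sum>l\<in>UNIV. w $ j * w $ l * ar2_cov (real (row_no j) - real (row_no l)))) {-pi..pi}"
    by (intro has_integral_sum has_integral_mult_right ar2_cov_integral) auto
  moreover have "(\<lambda>\<omega>. \<Sum>j\<in>UNIV. \<Sum>l\<in>UNIV. w $ j * w $ l *
       (cos ((real (row_no j) - real (row_no l)) * \<omega>) * ar2_kernel s \<theta> \<omega>)) = ?q"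
    by (simp add: norm_eq sum_distrib_right mult.assoc fun_eq_iff)
  moreover have "w \<bullet> (Sigma_mat ar2_density *v w) =
      (\<Sum>j\<in>UNIV. \<Sum>l\<in>UNIV. w $ j * w $ l * ar2_cov (real (row_no j) - real (row_no l))) / ar2_cov 0"
    by (simp add: inner_vec_def matrix_vector_mult_def Sigma_mat_ar2 sum_distrib_left
        sum_divide_distrib mult_ac)
  ultimately have eq: "w \<bullet> (Sigma_mat ar2_density *v w) = integral {-pi..pi} ?q / ar2_cov 0"
    by (simp add: integral_unique)
  have cont: "continuous_on {-pi..pi} ?q" by (intro continuous_intros)
  have nonneg: "0 \<le> ?q \<omega>" for \<omega> using ar2_kernel_pos[of \<omega>] by simp
  have "0 \<le> integral {-pi..pi} ?q"
    by (intro integral_nonneg integrable_continuous_real cont nonneg)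
  moreover have "integral {-pi..pi} ?q \<noteq> 0"
  proof
    assume "integral {-pi..pi} ?q = 0"
    moreover have "(integral {-pi..pi} ?q = 0) = (\<forall>x\<in>{-pi..pi}. ?q x = 0)"
      by (intro integral_eq_0_iff cont nonneg) (simp add: less_trans[of _ 0])
    ultimately have zero: "\<forall>x\<in>{-pi..pi}. ?q x = 0" by blast
    have "poly (vec_poly w) (cis x) = 0" if "x \<in> {0..pi}" for x
    proof -
      have "?q x = 0" using zero that pi_ge_zero by (intro bspec[OF zero]) auto
      then show ?thesis using ar2_kernel_pos[of x] by simp
    qed
    then have "cis ` {0..pi} \<subseteq> {z. poly (vec_poly w) z = 0}" by blast
    then have "finite (cis ` {0..pi})"
      using poly_roots_finite[OF vec_poly_nz[OF assms]] finite_subset by blast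
    then have "finite {0..pi}" using cis_inj_on finite_imageD by blast
    then show False using infinite_Icc[of 0 pi] by simp
  qed
  ultimately show ?thesis using ar2_cov_0_pos by (simp add: eq)
qed

end

text \<open>As s tends to 1, the Yule-Walker recursion turns into cos(x + \<theta>) = 2 cos \<theta>
  cos x - cos(x - \<theta>), and the first two values agree in the limit.\<close>

lemma ar2_cov_tendsto:
  "((\<lambda>s. ar2_cov s \<theta> (real m) / ar2_cov s \<theta> 0) \<longlongrightarrow> cos (real m * \<theta>)) (at_left 1)"
proof (induction m rule: less_induct)
  case (less m)
  have ev: "\<forall>\<^sub>F s in at_left (1::real). 0 < s \<and> s < 1"
    by (rule eventually_at_left_real[of 0 1, simplified, THEN eventually_mono]) auto
  consider "m = 0" | "m = 1" | k where "m = Suc (Suc k)"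
    by (metis One_nat_def not0_implies_Suc)
  then show ?case
  proof cases
    case 1
    have "\<forall>\<^sub>F s in at_left (1::real). 1 = ar2_cov s \<theta> (real m) / ar2_cov s \<theta> 0"
      using ev
    proof eventually_elim
      case (elim s)
      then show ?case using 1 ar2_cov_0_pos[of s \<theta>] by simp
    qed
    from Lim_transform_eventually[OF tendsto_const this] show ?thesis using 1 by simp
  next
    case 2
    have "\<forall>\<^sub>F s in at_left (1::real). 2 * s * cos \<theta> / (1 + s\<^sup>2) = ar2_cov s \<theta> (real m) / ar2_cov s \<theta> 0"
      using ev
    proof eventually_elim
      case (elim s)
      have "ar2_cov s \<theta> 1 * (1 + s\<^sup>2) = 2 * s * cos \<theta> * ar2_cov s \<theta> 0"
        using yule_walker[of s 1 \<theta>] ar2_cov_minus[of s \<theta> 1] elim by (simp add: algebra_simps)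
      moreover have "1 + s\<^sup>2 \<noteq> 0" by (metis add_pos_nonneg less_irrefl zero_le_power2 zero_less_one)
      ultimately show ?case using 2 ar2_cov_0_pos[of s \<theta>] elim by (simp add: field_simps)
    qed
    moreover have "((\<lambda>s. 2 * s * cos \<theta> / (1 + s\<^sup>2)) \<longlongrightarrow> 2 * 1 * cos \<theta> / (1 + 1\<^sup>2)) (at_left (1::real))"
      by (intro tendsto_intros) auto
    ultimately show ?thesis using 2 by (simp add: Lim_transform_eventually)
  next
    case (3 k)
    have "\<forall>\<^sub>F s in at_left (1::real).
        2 * s * cos \<theta> * (ar2_cov s \<theta> (real (Suc k)) / ar2_cov s \<theta> 0)
          - s\<^sup>2 * (ar2_cov s \<theta> (real k) / ar2_cov s \<theta> 0) = ar2_cov s \<theta> (real m) / ar2_cov s \<theta> 0"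
      using ev
    proof eventually_elim
      case (elim s)
      then show ?case
        using yule_walker[of s m \<theta>] 3 ar2_cov_0_pos[of s \<theta>] by (simp add: field_simps)
    qed
    moreover have "((\<lambda>s. 2 * s * cos \<theta> * (ar2_cov s \<theta> (real (Suc k)) / ar2_cov s \<theta> 0)
          - s\<^sup>2 * (ar2_cov s \<theta> (real k) / ar2_cov s \<theta> 0)) \<longlongrightarrow>
        2 * 1 * cos \<theta> * cos (real (Suc k) * \<theta>) - 1\<^sup>2 * cos (real k * \<theta>)) (at_left 1)"
      by (intro tendsto_intros less.IH) (use 3 in auto)
    moreover have "2 * 1 * cos \<theta> * cos (real (Suc k) * \<theta>) - 1\<^sup>2 * cos (real k * \<theta>) = cos (real m * \<theta>)"
    proof -
      have "cos (real m * \<theta>) = cos (real (Suc k) * \<theta> + \<theta>)"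
        and "cos (real k * \<theta>) = cos (real (Suc k) * \<theta> - \<theta>)"
        using 3 by (simp_all add: algebra_simps)
      then show ?thesis by (simp add: cos_add cos_diff)
    qed
    ultimately show ?thesis by (simp add: Lim_transform_eventually)
  qed
qed

text \<open>Only lags up to \<open>CARD('n)\<close> occur, so one s close to 1 serves for all
  entries. The limit is the covariance for the spectral measure with mass 1/2 at each of
  \<plusminus>\<theta>.\<close>

lemma AR2_approximates_point_mass:
  fixes \<theta> \<epsilon> :: real
  assumes "0 < \<epsilon>"
  shows "\<exists>f\<in>spec_AR2.
     (\<forall>w :: real^('n::{finite,linorder}). w \<noteq> 0 \<longrightarrow> 0 < w \<bullet> (Sigma_mat f *v w)) \<and>
     transpose (Sigma_mat f :: real^('n::{finite,linorder})^('n::{finite,linorder})) = Sigma_mat f \<and>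
     (\<forall>j l. \<bar>(Sigma_mat f :: real^('n::{finite,linorder})^('n::{finite,linorder})) $ j $ l - cos ((real (row_no j) - real (row_no l)) * \<theta>)\<bar> < \<epsilon>)"
proof -
  have "\<forall>\<^sub>F s in at_left (1::real). \<forall>m\<in>{..CARD('n)}.
      dist (ar2_cov s \<theta> (real m) / ar2_cov s \<theta> 0) (cos (real m * \<theta>)) < \<epsilon>"
    by (intro eventually_ball_finite ballI tendstoD ar2_cov_tendsto assms) simp
  moreover have "\<forall>\<^sub>F s in at_left (1::real). 0 < s \<and> s < 1"
    by (rule eventually_at_left_real[of 0 1, simplified, THEN eventually_mono]) auto
  ultimately have "\<forall>\<^sub>F s in at_left (1::real). (\<forall>m\<in>{..CARD('n)}.
      dist (ar2_cov s \<theta> (real m) / ar2_cov s \<theta> 0) (cos (real m * \<theta>)) < \<epsilon>) \<and> 0 < s \<and> s < 1"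
    by (rule eventually_conj)
  from eventually_happens'[OF trivial_limit_at_left_real this]
  obtain s where s: "0 < s" "s < 1" and close:
      "\<And>m. m \<le> CARD('n) \<Longrightarrow> \<bar>ar2_cov s \<theta> (real m) / ar2_cov s \<theta> 0 - cos (real m * \<theta>)\<bar> < \<epsilon>"
    by (auto simp: dist_real_def)
  let ?f = "ar2_density s \<theta>"
  have close': "\<bar>ar2_cov s \<theta> (real j - real l) / ar2_cov s \<theta> 0 - cos ((real j - real l) * \<theta>)\<bar> < \<epsilon>"
    if "j \<le> CARD('n)" "l \<le> CARD('n)" for j l
  proof (cases "l \<le> j")
    case True
    then show ?thesis using close[of "j - l"] that by (simp add: of_nat_diff)
  next
    case False
    then have "ar2_cov s \<theta> (real j - real l) = ar2_cov s \<theta> (real (l - j))"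
      using ar2_cov_minus[OF s, of \<theta> "real (l - j)"] by (simp add: of_nat_diff)
    moreover have "cos ((real j - real l) * \<theta>) = cos (real (l - j) * \<theta>)"
      using False cos_minus[of "real (l - j) * \<theta>"] by (simp add: of_nat_diff algebra_simps)
    ultimately show ?thesis using close[of "l - j"] that by simp
  qed
  have "transpose (Sigma_mat ?f :: real^('n::{finite,linorder})^('n::{finite,linorder})) = Sigma_mat ?f"
    using ar2_cov_minus[OF s, of \<theta>]
    by (simp add: vec_eq_iff transpose_def Sigma_mat_ar2[OF s]) (metis minus_diff_eq)
  then show ?thesis
    using ar2_density_in_spec_AR2[OF s] Sigma_mat_ar2_pos_definite[OF s] close'[OF row_no_le row_no_le]
    by (intro bexI[of _ ?f]) (auto simp: Sigma_mat_ar2[OF s])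
qed

section \<open>Taylor expansion of the trigonometric vectors\<close>

lemma inner_matrix_vector: "w \<bullet> (A *v x) = (transpose A *v w) \<bullet> (x :: real^'m)" for A :: "real^'m^'n"
  by (simp add: dot_lmul_matrix)

lemma norm_transpose_square:
  fixes A B :: "real^'n^'n"
  assumes "B ** transpose B = A"
  shows "(norm (transpose B *v w))\<^sup>2 = w \<bullet> (A *v w)"
  unfolding assms[symmetric] power2_norm_eq_inner
  by (simp add: inner_matrix_vector flip: matrix_vector_mul_assoc)

lemma invertible_if_pos_definite_square:
  fixes A B :: "real^'n^'n"
  assumes "B ** transpose B = A" "\<And>w. w \<noteq> 0 \<Longrightarrow> 0 < w \<bullet> (A *v w)"
  shows "invertible B"
proof -
  have "w = 0" if "transpose B *v w = 0" for w
    using assms(2)[of w] norm_transpose_square[OF assms(1), of w] that by auto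
  then have "\<exists>C. C ** transpose B = mat 1"
    using matrix_left_invertible_ker[of "transpose B"] by blast
  then show ?thesis
    using left_invertible_transpose invertible_right_inverse by blast
qed

lemma range_matrix_eq_col_span:
  fixes A :: "real^'m^'n"
  shows "range ((*v) A) = col_span A"
proof
  show "range ((*v) A) \<subseteq> col_span A"
    by (auto simp: col_span_def matrix_vector_mult_in_columnspace)
  have "subspace (range ((*v) A))"
    by (intro linear_subspace_image subspace_UNIV) simp
  moreover have "columns A \<subseteq> range ((*v) A)"
    by (metis columns_image_basis image_mono top_greatest)
  ultimately show "col_span A \<subseteq> range ((*v) A)"
    unfolding col_span_def by (rule span_minimal[rotated])
qed

text \<open>The span of \<open>E_mat s \<omega>\<close>, parametrized by a complex amplitude: 1
  gives the cosine column, \<open>- \<i>\<close> the sine column. Differentiation in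
  \<open>\<omega>\<close> multiplies the amplitude by \<open>\<i>\<close> and raises
  \<open>s\<close> by one.\<close>

definition trig_vec :: "nat \<Rightarrow> complex \<Rightarrow> real \<Rightarrow> real^('n::{finite,linorder})" where
  "trig_vec s \<zeta> \<omega> = (\<chi> j. Re (\<zeta> * of_nat (row_no j) ^ s * cis (real (row_no j) * \<omega>)))"

lemma trig_vec_in_col_span: "trig_vec s \<zeta> \<omega> \<in> col_span (E_mat s \<omega>)"
proof -
  have eq: "trig_vec s \<zeta> \<omega> =
      Re \<zeta> *\<^sub>R (\<chi> j. real (row_no j) ^ s * cos (real (row_no j) * \<omega>)) -
      Im \<zeta> *\<^sub>R (\<chi> j. real (row_no j) ^ s * sin (real (row_no j) * \<omega>))"
    by (simp add: trig_vec_def vec_eq_iff algebra_simps del: of_nat_power flip: of_nat_power)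
  show ?thesis
    unfolding eq col_span_def columns_E_mat
    by (intro span_diff span_scale span_base) simp_all
qed

lemma trig_vec_combination:
  "trig_vec s (of_real x * \<zeta> + of_real y * \<xi>) \<omega> = x *\<^sub>R trig_vec s \<zeta> \<omega> + y *\<^sub>R trig_vec s \<xi> \<omega>"
  by (simp add: trig_vec_def vec_eq_iff algebra_simps del: of_nat_power flip: of_nat_power)

lemma columns_E_mat_trig_vec: "columns (E_mat s \<omega>) = {trig_vec s 1 \<omega>, trig_vec s (- \<i>) \<omega>}"
  by (simp add: columns_E_mat trig_vec_def flip: of_nat_power)

text \<open>The term of order \<open>\<rho>\<close> is the first one not subtracted; what lies
  beyond it is O(h) after the division.\<close>

lemma cis_taylor_remainder_limit:
  "((\<lambda>h. (cis (r * h) - (\<Sum>s<\<rho>. (\<i> * of_real (r * h)) ^ s / fact s)) / of_real (h ^ \<rho>))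
     \<longlongrightarrow> (\<i> * of_real r) ^ \<rho> / fact \<rho>) (at 0)"
proof (rule Lim_transform)
  let ?g = "\<lambda>h::real. (cis (r * h) - (\<Sum>s<\<rho>. (\<i> * of_real (r * h)) ^ s / fact s)) / of_real (h ^ \<rho>)"
  show "((\<lambda>h::real. (\<i> * of_real r) ^ \<rho> / fact \<rho>) \<longlongrightarrow> (\<i> * of_real r) ^ \<rho> / fact \<rho>) (at 0)"
    by simp
  show "((\<lambda>h. ?g h - (\<i> * of_real r) ^ \<rho> / fact \<rho>) \<longlongrightarrow> 0) (at 0)"
  proof (rule Lim_null_comparison)
    show "\<forall>\<^sub>F h in at 0. norm (?g h - (\<i> * of_real r) ^ \<rho> / fact \<rho>) \<le> \<bar>r\<bar> ^ Suc \<rho> / fact (Suc \<rho>) * \<bar>h\<bar>"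
    proof (rule eventually_mono[OF eventually_neq_at_within])
      fix h :: real assume h: "h \<noteq> 0"
      have "?g h - (\<i> * of_real r) ^ \<rho> / fact \<rho> =
          (cis (r * h) - (\<Sum>s\<le>\<rho>. (\<i> * of_real (r * h)) ^ s / fact s)) / of_real (h ^ \<rho>)"
        using h by (simp add: lessThan_Suc_atMost[symmetric] field_simps power_mult_distrib)
      also have "norm \<dots> = norm (iexp (r * h) - (\<Sum>s\<le>\<rho>. (\<i> * of_real (r * h)) ^ s / fact s)) / \<bar>h\<bar> ^ \<rho>"
        by (simp add: norm_divide cis_conv_exp norm_power)
      also have "\<dots> \<le> (\<bar>r * h\<bar> ^ Suc \<rho> / fact (Suc \<rho>)) / \<bar>h\<bar> ^ \<rho>"
        by (intro divide_right_mono iexp_approx1) simp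
      also have "\<dots> = \<bar>r\<bar> ^ Suc \<rho> / fact (Suc \<rho>) * \<bar>h\<bar>"
        using h by (simp add: abs_mult power_mult_distrib)
      finally show "norm (?g h - (\<i> * of_real r) ^ \<rho> / fact \<rho>) \<le> \<bar>r\<bar> ^ Suc \<rho> / fact (Suc \<rho>) * \<bar>h\<bar>" .
    qed
    have "((\<lambda>h. \<bar>r\<bar> ^ Suc \<rho> / fact (Suc \<rho>) * \<bar>h\<bar>) \<longlongrightarrow> \<bar>r\<bar> ^ Suc \<rho> / fact (Suc \<rho>) * \<bar>0\<bar>) (at 0)"
      by (intro tendsto_intros)
    then show "((\<lambda>h. \<bar>r\<bar> ^ Suc \<rho> / fact (Suc \<rho>) * \<bar>h\<bar>) \<longlongrightarrow> 0) (at 0)" by simp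
  qed
qed

lemma trig_vec_taylor_limit:
  "((\<lambda>h. (1 / h ^ \<rho>) *\<^sub>R (trig_vec 0 \<zeta> (\<gamma> + h) - (\<Sum>s<\<rho>. (h ^ s / fact s) *\<^sub>R trig_vec s (\<zeta> * \<i> ^ s) \<gamma>)))
     \<longlongrightarrow> (1 / fact \<rho>) *\<^sub>R (trig_vec \<rho> (\<zeta> * \<i> ^ \<rho>) \<gamma> :: real^('n::{finite,linorder}))) (at 0)"
proof (rule vec_tendstoI)
  fix j :: 'n
  let ?r = "real (row_no j)"
  let ?L = "\<lambda>h. ((1 / h ^ \<rho>) *\<^sub>R (trig_vec 0 \<zeta> (\<gamma> + h) - (\<Sum>s<\<rho>. (h ^ s / fact s) *\<^sub>R trig_vec s (\<zeta> * \<i> ^ s) \<gamma>))) $ j"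
  have Re_scale: "Re (of_real a * z) = a * Re z" for a z by simp
  have eq: "Re (\<zeta> * cis (?r * \<gamma>) *
      ((cis (?r * h) - (\<Sum>s<\<rho>. (\<i> * of_real (?r * h)) ^ s / fact s)) / of_real (h ^ \<rho>))) = ?L h" for h
  proof -
    have "\<zeta> * cis (?r * \<gamma>) *
        ((cis (?r * h) - (\<Sum>s<\<rho>. (\<i> * of_real (?r * h)) ^ s / fact s)) / of_real (h ^ \<rho>)) =
      of_real (1 / h ^ \<rho>) * (\<zeta> * cis (?r * (\<gamma> + h)) -
        (\<Sum>s<\<rho>. of_real (h ^ s / fact s) * (\<zeta> * \<i> ^ s * of_nat (row_no j) ^ s * cis (?r * \<gamma>))))"
      by (simp add: ring_distribs cis_mult[symmetric] sum_distrib_left power_mult_distrib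
          diff_divide_distrib sum_divide_distrib mult_ac)
    then have "Re (\<zeta> * cis (?r * \<gamma>) *
        ((cis (?r * h) - (\<Sum>s<\<rho>. (\<i> * of_real (?r * h)) ^ s / fact s)) / of_real (h ^ \<rho>))) =
      (1 / h ^ \<rho>) * (Re (\<zeta> * cis (?r * (\<gamma> + h))) -
        (\<Sum>s<\<rho>. (h ^ s / fact s) * Re (\<zeta> * \<i> ^ s * of_nat (row_no j) ^ s * cis (?r * \<gamma>))))"
      by (simp only: Re_scale minus_complex.sel Re_sum)
    then show ?thesis by (simp add: trig_vec_def)
  qed
  have "((\<lambda>h. Re (\<zeta> * cis (?r * \<gamma>) *
      ((cis (?r * h) - (\<Sum>s<\<rho>. (\<i> * of_real (?r * h)) ^ s / fact s)) / of_real (h ^ \<rho>))))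
      \<longlongrightarrow> Re (\<zeta> * cis (?r * \<gamma>) * ((\<i> * of_real ?r) ^ \<rho> / fact \<rho>))) (at 0)"
    by (intro tendsto_Re tendsto_mult_left cis_taylor_remainder_limit)
  moreover have "\<zeta> * cis (?r * \<gamma>) * ((\<i> * of_real ?r) ^ \<rho> / fact \<rho>) =
      of_real (1 / fact \<rho>) * (\<zeta> * \<i> ^ \<rho> * of_nat (row_no j) ^ \<rho> * cis (?r * \<gamma>))"
    by (simp add: power_mult_distrib mult_ac)
  ultimately show "((\<lambda>h. ?L h) \<longlongrightarrow> ((1 / fact \<rho>) *\<^sub>R trig_vec \<rho> (\<zeta> * \<i> ^ \<rho>) \<gamma>) $ j) (at 0)"
    unfolding eq by (simp only: Re_scale trig_vec_def vector_scaleR_component vec_lambda_beta real_scaleR_def)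
qed

text \<open>\<open>P\<close> annihilates the subtracted Taylor terms, so the first derivative
  visible through \<open>P\<close> is that of order \<open>\<rho>\<close>.\<close>

lemma trig_vec_projection_limit:
  fixes P :: "real^('n::{finite,linorder})^'m"
  assumes "\<And>s \<xi>. s < \<rho> \<Longrightarrow> P *v trig_vec s \<xi> \<gamma> = 0"
  shows "((\<lambda>h. (1 / h ^ \<rho>) *\<^sub>R (P *v trig_vec 0 \<zeta> (\<gamma> + h))) \<longlongrightarrow>
     (1 / fact \<rho>) *\<^sub>R (P *v trig_vec \<rho> (\<zeta> * \<i> ^ \<rho>) \<gamma>)) (at 0)"
proof -
  have lin: "linear ((*v) P)" by simp
  have shift: "P *v ((1 / h ^ \<rho>) *\<^sub>R (trig_vec 0 \<zeta> (\<gamma> + h) - (\<Sum>s<\<rho>. (h ^ s / fact s) *\<^sub>R trig_vec s (\<zeta> * \<i> ^ s) \<gamma>)))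
     = (1 / h ^ \<rho>) *\<^sub>R (P *v trig_vec 0 \<zeta> (\<gamma> + h))" for h
    by (simp add: linear_scale[OF lin] linear_diff[OF lin] linear_sum[OF lin] assms)
  have "((\<lambda>h. P *v ((1 / h ^ \<rho>) *\<^sub>R (trig_vec 0 \<zeta> (\<gamma> + h) -
       (\<Sum>s<\<rho>. (h ^ s / fact s) *\<^sub>R trig_vec s (\<zeta> * \<i> ^ s) \<gamma>))))
     \<longlongrightarrow> P *v ((1 / fact \<rho>) *\<^sub>R trig_vec \<rho> (\<zeta> * \<i> ^ \<rho>) \<gamma>)) (at 0)"
    by (rule bounded_linear.tendsto[OF matrix_vector_mul_bounded_linear trig_vec_taylor_limit])
  then show ?thesis unfolding shift unfolding linear_scale[OF lin] .
qed

text \<open>By the addition theorem, the matrix with entries cos((j - l) \<theta>) is the sum of the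
  outer products of the cosine and the sine vector.\<close>

lemma quadratic_form_near_point_mass:
  fixes A :: "real^('n::{finite,linorder})^('n::{finite,linorder})" and u :: "real^('n::{finite,linorder})"
  assumes "\<And>j l. \<bar>A $ j $ l - cos ((real (row_no j) - real (row_no l)) * \<theta>)\<bar> < \<epsilon>"
  shows "\<bar>u \<bullet> (A *v u) - ((u \<bullet> trig_vec 0 1 \<theta>)\<^sup>2 + (u \<bullet> trig_vec 0 (- \<i>) \<theta>)\<^sup>2)\<bar>
     \<le> \<epsilon> * (\<Sum>j\<in>UNIV. \<Sum>l\<in>UNIV. \<bar>u $ j * u $ l\<bar>)"
proof -
  let ?c = "\<lambda>j l. cos ((real (row_no j) - real (row_no l)) * \<theta>)"
  have A: "u \<bullet> (A *v u) = (\<Sum>j\<in>UNIV. \<Sum>l\<in>UNIV. u $ j * u $ l * A $ j $ l)"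
    by (simp add: inner_vec_def matrix_vector_mult_def sum_distrib_left mult_ac)
  have c: "(u \<bullet> trig_vec 0 1 \<theta>)\<^sup>2 + (u \<bullet> trig_vec 0 (- \<i>) \<theta>)\<^sup>2 =
      (\<Sum>j\<in>UNIV. \<Sum>l\<in>UNIV. u $ j * u $ l * ?c j l)"
    by (simp add: inner_vec_def trig_vec_def power2_eq_square sum_product left_diff_distrib cos_diff
        algebra_simps sum.distrib)
  have "\<bar>u \<bullet> (A *v u) - ((u \<bullet> trig_vec 0 1 \<theta>)\<^sup>2 + (u \<bullet> trig_vec 0 (- \<i>) \<theta>)\<^sup>2)\<bar> =
      \<bar>\<Sum>j\<in>UNIV. \<Sum>l\<in>UNIV. u $ j * u $ l * (A $ j $ l - ?c j l)\<bar>"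
    unfolding A c by (simp add: sum_subtractf[symmetric] right_diff_distrib)
  also have "\<dots> \<le> (\<Sum>j\<in>UNIV. \<Sum>l\<in>UNIV. \<bar>u $ j * u $ l * (A $ j $ l - ?c j l)\<bar>)"
    by (rule order_trans[OF sum_abs sum_mono[OF sum_abs]])
  also have "\<dots> \<le> (\<Sum>j\<in>UNIV. \<Sum>l\<in>UNIV. \<bar>u $ j * u $ l\<bar> * \<epsilon>)"
    by (intro sum_mono) (use assms less_imp_le in \<open>auto simp: abs_mult[of "_ * _"] intro!: mult_left_mono\<close>)
  finally show ?thesis by (simp add: sum_distrib_left mult.commute)
qed

text \<open>The factor \<open>B\<close> of a covariance matrix is only known through \<open>B B'\<close>, that is, through the
  norms of \<open>B' w\<close>; a limit of the factors is obtained by compactness.\<close>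
lemma convergent_subseq_if_norm_transpose_convergent:
  fixes B :: "nat \<Rightarrow> real^'m^'n"
  assumes "\<And>w. (\<lambda>m. (norm (transpose (B m) *v w))\<^sup>2) \<longlonglongrightarrow> q w"
  obtains \<phi> L where "strict_mono \<phi>" "(B \<circ> \<phi>) \<longlonglongrightarrow> L" "\<And>w. (norm (transpose L *v w))\<^sup>2 = q w"
proof -
  \<comment> \<open>For a unit vector \<open>w\<close> the hypothesis controls the norm of one row
    of \<open>B m\<close>; all rows together give boundedness.\<close>
  have row: "transpose (B m) *v axis i 1 = B m $ i" for m i
    by (simp add: matrix_vector_mul_component vec_eq_iff matrix_vector_mult_def transpose_def axis_def
        if_distrib cong: if_cong)
  have "\<exists>K. \<forall>m. norm (B m $ i) \<le> K" for i
  proof -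
    have "Bseq (\<lambda>m. (norm (B m $ i))\<^sup>2)"
      using convergent_imp_Bseq[OF convergentI[OF assms[of "axis i 1"]]] by (simp only: row)
    then obtain K where K: "0 < K" "\<And>m. (norm (B m $ i))\<^sup>2 \<le> K"
      by (auto elim!: BseqE)
    then have "norm (B m $ i) \<le> sqrt K" for m by (simp add: real_le_rsqrt)
    then show ?thesis by blast
  qed
  then obtain K where K: "\<And>m i. norm (B m $ i) \<le> K i" by metis
  have "norm (B m) \<le> (\<Sum>i\<in>UNIV. K i)" for m
    unfolding norm_vec_def[of "B m"]
    by (rule order_trans[OF L2_set_le_sum]) (auto intro!: sum_mono K)
  then have "bounded (range B)" by (auto simp: bounded_iff)
  from bounded_imp_convergent_subsequence[OF this]
  obtain L \<phi> where \<phi>: "strict_mono \<phi>" "(B \<circ> \<phi>) \<longlonglongrightarrow> L" by blast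
  have "(norm (transpose L *v w))\<^sup>2 = q w" for w
  proof -
    have "(\<lambda>m. (norm (transpose (B (\<phi> m)) *v w))\<^sup>2) \<longlonglongrightarrow> q w"
      using LIMSEQ_subseq_LIMSEQ[OF assms \<phi>(1)] by (simp add: o_def)
    moreover have "(\<lambda>m. transpose (B (\<phi> m)) *v w) \<longlonglongrightarrow> transpose L *v w"
      unfolding matrix_vector_mult_def transpose_def
      using \<phi>(2) by (intro vec_tendstoI) (auto simp: o_def intro!: tendsto_intros)
    then have "(\<lambda>m. (norm (transpose (B (\<phi> m)) *v w))\<^sup>2) \<longlonglongrightarrow> (norm (transpose L *v w))\<^sup>2"
      by (intro tendsto_intros)
    ultimately show ?thesis using LIMSEQ_unique by blast
  qed
  with \<phi> show ?thesis by (rule that)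
qed

section \<open>Concentration and the size of the test\<close>

text \<open>\<open>T (y) \<ge> \<bar>R \<beta>(y) - r\<bar>\<^sup>2 / \<parallel>\<Omega>(y)\<parallel>\<close>, with the sum of the absolute entries as the norm. Clearing the
  denominator keeps the set meaningful where \<open>\<Omega>\<close> is singular.\<close>
definition large_F_set ::
  "real^'k^'q \<Rightarrow> real^'q \<Rightarrow> (real^'n \<Rightarrow> real^'k) \<Rightarrow> (real^'n \<Rightarrow> real^'q^'q) \<Rightarrow> real \<Rightarrow> (real^'n) set" where
  "large_F_set R r bc Oc C =
     {y. C * (\<Sum>i\<in>UNIV. \<Sum>j\<in>UNIV. \<bar>Oc y $ i $ j\<bar>) < (R *v bc y - r) \<bullet> (R *v bc y - r)}"

lemma open_large_F_set:
  assumes "continuous_on UNIV bc" "continuous_on UNIV Oc"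
  shows "open (large_F_set R r bc Oc C)"
  unfolding large_F_set_def by (intro open_Collect_less continuous_intros assms)

lemma F_type_stat_ge:
  assumes sym: "transpose (Oc y) = Oc y" and nnd: "nonneg_definite (Oc y)"
    and y: "y \<in> large_F_set R r bc Oc C" "det (Oc y) \<noteq> 0"
  shows "C \<le> F_type_stat R r bc Oc {} y"
proof -
  let ?v = "R *v bc y - r"
  define K where "K = (\<Sum>i\<in>UNIV. \<Sum>j\<in>UNIV. \<bar>Oc y $ i $ j\<bar>)"
  have "K \<noteq> 0"
  proof
    assume "K = 0"
    then have "row i (Oc y) = 0" for i
      by (simp add: K_def sum_nonneg_eq_0_iff sum_nonneg vec_eq_iff row_def)
    then show False using y(2) det_zero_row(1) by blast
  qed
  then have K: "0 < K" unfolding K_def by (simp add: sum_nonneg order_less_le)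
  have "C * K < ?v \<bullet> ?v" using y(1) by (simp add: large_F_set_def K_def)
  then have "C \<le> (?v \<bullet> ?v) / K" using K by (simp add: field_simps)
  also have "\<dots> \<le> ?v \<bullet> (matrix_inv (Oc y) *v ?v)"
    by (rule quadratic_form_inv_lower_bound[OF sym nnd _ K])
      (use y(2) quadratic_form_le_sum_abs in \<open>auto simp: invertible_det_nz K_def\<close>)
  finally show ?thesis using y(2) by (simp add: F_type_stat_def N_star_def)
qed

section \<open>Equivariance of the estimators\<close>

context
  fixes X :: "real^'k^'n" and bc :: "real^'n \<Rightarrow> real^'k" and Oc :: "real^'n \<Rightarrow> real^'q^'q"
  assumes est: "estimator_conditions X bc Oc {}"
begin

lemma bc_affine: "\<delta> \<noteq> 0 \<Longrightarrow> bc (\<delta> *\<^sub>R y + X *v \<eta>) = \<delta> *\<^sub>R bc y + \<eta>"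
  and Oc_affine: "\<delta> \<noteq> 0 \<Longrightarrow> Oc (\<delta> *\<^sub>R y + X *v \<eta>) = \<delta>\<^sup>2 *\<^sub>R Oc y"
  using est by (auto simp: estimator_conditions_def)

text \<open>As \<open>N\<close> is empty, equivariance may be used at 0, where
  \<open>\<delta> = 2\<close> forces \<open>bc 0 = 0\<close>. The next lemma repeats this for
  \<open>Oc\<close>.\<close>

lemma bc_col_space: "bc (X *v \<eta>) = \<eta>"
proof -
  have "bc 0 = 0" using bc_affine[of 2 0 0] by (simp add: scaleR_2)
  then show ?thesis using bc_affine[of 1 0 \<eta>] by simp
qed

lemma Oc_col_space: "Oc (X *v \<eta>) = 0"
proof -
  have "Oc 0 = 0" using Oc_affine[of 2 0 0] by (simp add: vec_eq_iff)
  then show ?thesis using Oc_affine[of 1 0 \<eta>] by simp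
qed

text \<open>\<open>Oc\<close> vanishes here, so the defining inequality compares 0, whatever
  \<open>C\<close> is, with the squared norm of \<open>R *v \<eta>\<close>.\<close>

lemma col_space_in_large_F_set:
  assumes "R *v \<beta> = r" "R *v \<eta> \<noteq> 0"
  shows "X *v \<beta> + X *v \<eta> \<in> large_F_set R r bc Oc C"
proof -
  have "R *v (\<beta> + \<eta>) - r = R *v \<eta>" using assms(1) by (simp add: matrix_vector_right_distrib)
  then show ?thesis
    using assms(2) bc_col_space[of "\<beta> + \<eta>"] Oc_col_space[of "\<beta> + \<eta>"]
    by (simp add: large_F_set_def flip: matrix_vector_right_distrib)
qed

text \<open>Scaling about \<open>X *v \<beta>\<close> is scaling about 0 followed by a translation
  in the column space, so equivariance applies; both sides of the defining inequality acquire the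
  factor \<open>\<delta>\<^sup>2\<close>.\<close>

lemma large_F_set_invariant:
  assumes "R *v \<beta> = r" "R *v \<eta> = 0" "\<delta> \<noteq> 0"
  shows "X *v \<beta> + \<delta> *\<^sub>R y + X *v \<eta> \<in> large_F_set R r bc Oc C \<longleftrightarrow>
    X *v \<beta> + y \<in> large_F_set R r bc Oc C"
proof -
  let ?y = "X *v \<beta> + y"
  have "X *v \<beta> + \<delta> *\<^sub>R y + X *v \<eta> = \<delta> *\<^sub>R ?y + X *v (\<beta> - \<delta> *\<^sub>R \<beta> + \<eta>)"
    by (simp add: matrix_vector_right_distrib matrix_vector_mult_diff_distrib
        matrix_vector_mult_scaleR algebra_simps)
  then have bc: "bc (X *v \<beta> + \<delta> *\<^sub>R y + X *v \<eta>) = \<delta> *\<^sub>R bc ?y + (\<beta> - \<delta> *\<^sub>R \<beta> + \<eta>)"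
    and Oc: "Oc (X *v \<beta> + \<delta> *\<^sub>R y + X *v \<eta>) = \<delta>\<^sup>2 *\<^sub>R Oc ?y"
    using bc_affine Oc_affine assms(3) by simp_all
  have "R *v bc (X *v \<beta> + \<delta> *\<^sub>R y + X *v \<eta>) - r = \<delta> *\<^sub>R (R *v bc ?y - r)"
    unfolding bc using assms(1,2)
    by (simp add: matrix_vector_right_distrib matrix_vector_mult_diff_distrib
        matrix_vector_mult_scaleR algebra_simps)
  moreover have "(\<Sum>i\<in>UNIV. \<Sum>j\<in>UNIV. \<bar>Oc (X *v \<beta> + \<delta> *\<^sub>R y + X *v \<eta>) $ i $ j\<bar>) =
      \<delta>\<^sup>2 * (\<Sum>i\<in>UNIV. \<Sum>j\<in>UNIV. \<bar>Oc ?y $ i $ j\<bar>)"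
    unfolding Oc by (simp add: abs_mult sum_distrib_left)
  moreover have "C * (\<delta>\<^sup>2 * K) < (\<delta> *\<^sub>R v) \<bullet> (\<delta> *\<^sub>R v) \<longleftrightarrow> C * K < v \<bullet> v" for K and v :: "real^'d"
  proof -
    have "C * (\<delta>\<^sup>2 * K) = \<delta>\<^sup>2 * (C * K)" "(\<delta> *\<^sub>R v) \<bullet> (\<delta> *\<^sub>R v) = \<delta>\<^sup>2 * (v \<bullet> v)"
      by (simp_all add: power2_eq_square)
    then show ?thesis using assms(3) by (simp only: mult_less_cancel_left_pos zero_less_power2 not_False_eq_True)
  qed
  ultimately show ?thesis by (simp only: large_F_set_def mem_Collect_eq)
qed

end

text \<open>In the proof, \<open>d m\<close> is the offset of the pole angle from \<open>\<gamma>\<close>, and the covariance matrix is within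
  \<open>d m ^ (2 * \<rho> + 1)\<close> of its limit for a pole on the circle: small enough to survive the
  rescaling by \<open>h m = 1 / d m ^ \<rho>\<close>.\<close>
lemma exists_concentrating_sequence:
  fixes P :: "real^('n::{finite,linorder})^('n::{finite,linorder})"
  assumes P: "\<And>s \<xi>. s < \<rho> \<Longrightarrow> P *v trig_vec s \<xi> \<gamma> = 0" and \<sigma>2: "0 < \<sigma>2"
  obtains f h and B :: "nat \<Rightarrow> real^('n::{finite,linorder})^('n::{finite,linorder})" and L
  where "\<And>m. f m \<in> spec_AR2" "\<And>m. h m \<noteq> (0::real)"
    "\<And>m. B m = (SOME B. B ** transpose B = \<sigma>2 *\<^sub>R Sigma_mat (f m))" "\<And>m. invertible (B m)"
    "(\<lambda>m. h m *\<^sub>R (P ** B m)) \<longlonglongrightarrow> L"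
    "\<And>w. (norm (transpose L *v w))\<^sup>2 = \<sigma>2 *
       ((w \<bullet> ((1 / fact \<rho>) *\<^sub>R (P *v trig_vec \<rho> (\<i> ^ \<rho>) \<gamma>)))\<^sup>2 +
        (w \<bullet> ((1 / fact \<rho>) *\<^sub>R (P *v trig_vec \<rho> (- \<i> * \<i> ^ \<rho>) \<gamma>)))\<^sup>2)"
proof -
  define d where "d m = 1 / real (Suc m)" for m
  have d_pos: "0 < d m" for m by (simp add: d_def)
  have "d \<longlonglongrightarrow> 0" unfolding d_def using LIMSEQ_inverse_real_of_nat by (simp add: inverse_eq_divide)
  then have d_lim: "filterlim d (at 0) sequentially"
    by (rule filterlim_atI) (simp add: d_def)
  let ?\<epsilon> = "\<lambda>m. d m ^ (2 * \<rho> + 1)"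
  have "\<exists>f\<in>spec_AR2.
     (\<forall>w :: real^('n::{finite,linorder}). w \<noteq> 0 \<longrightarrow> 0 < w \<bullet> (Sigma_mat f *v w)) \<and>
     transpose (Sigma_mat f :: real^('n::{finite,linorder})^('n::{finite,linorder})) = Sigma_mat f \<and>
     (\<forall>j l. \<bar>(Sigma_mat f :: real^('n::{finite,linorder})^('n::{finite,linorder})) $ j $ l - cos ((real (row_no j) - real (row_no l)) * (\<gamma> + d m))\<bar> < ?\<epsilon> m)" for m
    by (rule AR2_approximates_point_mass) (simp add: d_pos)
  then obtain f where f: "\<And>m. f m \<in> spec_AR2"
      "\<And>m w. w \<noteq> 0 \<Longrightarrow> 0 < w \<bullet> ((Sigma_mat (f m) :: real^('n::{finite,linorder})^('n::{finite,linorder})) *v w)"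
      "\<And>m. transpose (Sigma_mat (f m) :: real^('n::{finite,linorder})^('n::{finite,linorder})) = Sigma_mat (f m)"
      "\<And>m j l. \<bar>(Sigma_mat (f m) :: real^('n::{finite,linorder})^('n::{finite,linorder})) $ j $ l - cos ((real (row_no j) - real (row_no l)) * (\<gamma> + d m))\<bar> < ?\<epsilon> m"
    by metis
  define S where "S m = (Sigma_mat (f m) :: real^('n::{finite,linorder})^('n::{finite,linorder}))" for m
  \<comment> \<open>The same choice of factor as in \<open>gaussian_measure\<close>, so that
    \<open>B m\<close> describes exactly that measure.\<close>
  define B where "B m = (SOME B :: real^('n::{finite,linorder})^('n::{finite,linorder}). B ** transpose B = \<sigma>2 *\<^sub>R S m)" for m
  have pd: "0 < w \<bullet> ((\<sigma>2 *\<^sub>R S m) *v w)" if "w \<noteq> 0" for w m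
    using f(2)[OF that] \<sigma>2 by (simp add: S_def flip: scaleR_matrix_vector_assoc)
  have "transpose (\<sigma>2 *\<^sub>R S m) = \<sigma>2 *\<^sub>R S m" for m
    using f(3)[of m] by (simp add: S_def transpose_def vec_eq_iff)
  then have "\<exists>B :: real^('n::{finite,linorder})^('n::{finite,linorder}). B ** transpose B = \<sigma>2 *\<^sub>R S m" for m
    by (rule pos_definite_factorization) (rule pd)
  then have B: "B m ** transpose (B m) = \<sigma>2 *\<^sub>R S m" for m
    unfolding B_def by (rule someI_ex)
  have inv: "invertible (B m)" for m
    using B pd by (rule invertible_if_pos_definite_square)
  define h where "h m = 1 / d m ^ \<rho>" for m
  have h: "h m \<noteq> 0" for m using d_pos[of m] by (simp add: h_def)
  define a where "a \<zeta> = (1 / fact \<rho>) *\<^sub>R (P *v trig_vec \<rho> (\<zeta> * \<i> ^ \<rho>) \<gamma>)" for \<zeta>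
  have a_lim: "(\<lambda>m. h m *\<^sub>R (P *v trig_vec 0 \<zeta> (\<gamma> + d m))) \<longlonglongrightarrow> a \<zeta>" for \<zeta>
    unfolding h_def a_def by (rule filterlim_compose[OF trig_vec_projection_limit[OF P] d_lim])
  have "(\<lambda>m. (norm (transpose (h m *\<^sub>R (P ** B m)) *v w))\<^sup>2) \<longlonglongrightarrow> \<sigma>2 * ((w \<bullet> a 1)\<^sup>2 + (w \<bullet> a (- \<i>))\<^sup>2)" for w
  proof -
    define u where "u = transpose P *v w"
    define K where "K = (\<Sum>j\<in>UNIV. \<Sum>l\<in>UNIV. \<bar>u $ j * u $ l\<bar>)"
    \<comment> \<open>The rescaled quadratic form with the covariance replaced by its limit for
      poles on the circle.\<close>
    define G where "G m = (w \<bullet> (h m *\<^sub>R (P *v trig_vec 0 1 (\<gamma> + d m))))\<^sup>2 +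
        (w \<bullet> (h m *\<^sub>R (P *v trig_vec 0 (- \<i>) (\<gamma> + d m))))\<^sup>2" for m
    have norm_eq: "(norm (transpose (h m *\<^sub>R (P ** B m)) *v w))\<^sup>2 = \<sigma>2 * ((h m)\<^sup>2 * (u \<bullet> (S m *v u)))" for m
    proof -
      have "transpose (h m *\<^sub>R (P ** B m)) *v w = h m *\<^sub>R (transpose (B m) *v u)"
        by (simp only: u_def transpose_scalar matrix_transpose_mul matrix_vector_mul_assoc
            flip: scaleR_matrix_vector_assoc)
      then have "(norm (transpose (h m *\<^sub>R (P ** B m)) *v w))\<^sup>2 = (h m)\<^sup>2 * (norm (transpose (B m) *v u))\<^sup>2"
        by (simp add: power_mult_distrib)
      then show ?thesis
        by (simp only: norm_transpose_square[OF B] scaleR_matrix_vector_assoc[symmetric]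
            inner_scaleR_right mult_ac)
    qed
    have "\<bar>(h m)\<^sup>2 * (u \<bullet> (S m *v u)) - G m\<bar> \<le> d m * K" for m
    proof -
      have "G m = (h m)\<^sup>2 * ((u \<bullet> trig_vec 0 1 (\<gamma> + d m))\<^sup>2 + (u \<bullet> trig_vec 0 (- \<i>) (\<gamma> + d m))\<^sup>2)"
        by (simp add: G_def u_def inner_matrix_vector power_mult_distrib distrib_left)
      then have "\<bar>(h m)\<^sup>2 * (u \<bullet> (S m *v u)) - G m\<bar> = (h m)\<^sup>2 *
          \<bar>u \<bullet> (S m *v u) - ((u \<bullet> trig_vec 0 1 (\<gamma> + d m))\<^sup>2 + (u \<bullet> trig_vec 0 (- \<i>) (\<gamma> + d m))\<^sup>2)\<bar>"
        by (simp add: abs_mult flip: right_diff_distrib)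
      also have "\<dots> \<le> (h m)\<^sup>2 * (?\<epsilon> m * K)"
        unfolding K_def S_def by (intro mult_left_mono quadratic_form_near_point_mass f(4)) simp
      also have "\<dots> = d m * K"
        using d_pos[of m] by (simp add: h_def power_divide power_mult[symmetric] mult.commute)
      finally show ?thesis .
    qed
    then have "\<forall>\<^sub>F m in sequentially. norm ((h m)\<^sup>2 * (u \<bullet> (S m *v u)) - G m) \<le> d m * K" by simp
    moreover have "(\<lambda>m. d m * K) \<longlonglongrightarrow> 0"
      using tendsto_mult_left_zero[OF \<open>d \<longlonglongrightarrow> 0\<close>] .
    ultimately have "(\<lambda>m. (h m)\<^sup>2 * (u \<bullet> (S m *v u)) - G m) \<longlonglongrightarrow> 0"
      by (rule Lim_null_comparison)
    moreover have "G \<longlonglongrightarrow> (w \<bullet> a 1)\<^sup>2 + (w \<bullet> a (- \<i>))\<^sup>2"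
      unfolding G_def by (intro tendsto_intros a_lim)
    ultimately have "(\<lambda>m. (h m)\<^sup>2 * (u \<bullet> (S m *v u))) \<longlonglongrightarrow> (w \<bullet> a 1)\<^sup>2 + (w \<bullet> a (- \<i>))\<^sup>2"
      by (rule Lim_transform[rotated])
    then show ?thesis unfolding norm_eq by (rule tendsto_mult_left)
  qed
  from convergent_subseq_if_norm_transpose_convergent[OF this]
  obtain \<phi> L where \<phi>: "strict_mono \<phi>" "((\<lambda>m. h m *\<^sub>R (P ** B m)) \<circ> \<phi>) \<longlonglongrightarrow> L"
    "\<And>w. (norm (transpose L *v w))\<^sup>2 = \<sigma>2 * ((w \<bullet> a 1)\<^sup>2 + (w \<bullet> a (- \<i>))\<^sup>2)" by blast
  show ?thesis
    by (rule that[of "f \<circ> \<phi>" "h \<circ> \<phi>" "B \<circ> \<phi>" L])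
      (use f(1) h inv \<phi> in \<open>auto simp: B_def S_def o_def a_def\<close>)
qed

theorem theorem3p10:
  fixes X :: "real^'k^('n::{finite,linorder})"
    and R :: "real^'k^'q"
    and r :: "real^'q"
    and bc :: "real^('n::{finite,linorder}) \<Rightarrow> real^'k"
    and Oc :: "real^('n::{finite,linorder}) \<Rightarrow> real^'q^'q"
    and T :: "real^('n::{finite,linorder}) \<Rightarrow> real"
    and F :: "(real \<Rightarrow> real) set"
    and \<gamma> :: real
  assumes "CARD('k) < CARD('n)"
    and "rank X = CARD('k)"
    and "rank R = CARD('q)"
    and "F \<subseteq> spec_all"
    and "spec_AR2 \<subseteq> F"
    and "estimator_conditions X bc Oc {}"
    and "T = F_type_stat R r bc Oc {}"
    and "\<And>y. nonneg_definite (Oc y)"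
    and "\<gamma> \<in> {0..pi}"
    and "col_span (E_mat (rho \<gamma> (M0_lin X R)) \<gamma>) \<subseteq> col_span X"
  shows "kappa_vec (omega_vec (M0_lin X R)) (d_vec (M0_lin X R)) + kappa \<gamma> 1 < CARD('n) \<and>
         (\<forall>C :: real. \<forall>\<mu>0 \<in> M0 X R r. \<forall>\<sigma>2 > 0.
            (SUP f\<in>F. measure (gaussian_measure \<mu>0 (\<sigma>2 *\<^sub>R Sigma_mat f)) {y. C \<le> T y}) = 1)"
proof -
  define L where "L = M0_lin X R"
  define \<rho> where "\<rho> = rho \<gamma> L"
  have M: "col_span X = range ((*v) X)" by (rule range_matrix_eq_col_span[symmetric])
  have LM: "L \<subseteq> col_span X" by (auto simp: L_def M0_lin_def M)
  have subL: "subspace L"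
  proof -
    have "subspace {\<beta>. R *v \<beta> = 0}" by (simp add: linear_subspace_kernel)
    then have "subspace ((*v) X ` {\<beta>. R *v \<beta> = 0})" by (intro linear_subspace_image) simp_all
    moreover have "(*v) X ` {\<beta>. R *v \<beta> = 0} = L" by (auto simp: L_def M0_lin_def)
    ultimately show ?thesis by simp
  qed
  have "dim (columns X) < DIM(real^('n::{finite,linorder}))"
    using assms(1,2) by (simp add: column_rank_def)
  then obtain w where w: "w \<noteq> 0" "\<And>y. y \<in> col_span X \<Longrightarrow> w \<bullet> y = 0"
    unfolding col_span_def using orthogonal_to_subspace_exists[of "columns X"]
    by (auto simp: orthogonal_def)
  have kappa: "kappa_vec (omega_vec L) (d_vec L) + kappa \<gamma> 1 < CARD('n)"
    by (rule kappa_condition[OF w(1) assms(9)]) (use w(2) LM assms(10) L_def in blast)+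
  have not_sub: "\<not> col_span (E_mat \<rho> \<gamma>) \<subseteq> L"
    unfolding \<rho>_def by (rule E_mat_rho_not_subset[OF w(1)]) (use w(2) LM in blast)
  obtain P :: "real^('n::{finite,linorder})^('n::{finite,linorder})" where
    P: "\<And>y. y \<in> L \<Longrightarrow> P *v y = 0" "\<And>y. y - P *v y \<in> L"
    using exists_projection[OF subL] by blast
  have Ptrig: "P *v trig_vec s \<xi> \<gamma> = 0" if "s < \<rho>" for s \<xi>
    using that trig_vec_in_col_span[of s \<xi> \<gamma>] E_mat_subset_if_less_rho[of s \<gamma> L]
    unfolding \<rho>_def by (intro P(1)) blast
  \<comment> \<open>The column space modulo \<open>L\<close>; it contains \<open>a\<close> and
    \<open>b\<close> because the columns of \<open>E_mat \<rho> \<gamma>\<close> lie in the column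
    space of \<open>X\<close>.\<close>
  define PM where "PM = (*v) P ` col_span X"
  have subPM: "subspace PM"
    unfolding PM_def by (intro linear_subspace_image) (simp_all add: col_span_def)
  define a where "a = (1 / fact \<rho>) *\<^sub>R (P *v trig_vec \<rho> (\<i> ^ \<rho>) \<gamma>)"
  define b where "b = (1 / fact \<rho>) *\<^sub>R (P *v trig_vec \<rho> (- \<i> * \<i> ^ \<rho>) \<gamma>)"
  have "trig_vec \<rho> \<xi> \<gamma> \<in> col_span X" for \<xi>
    using trig_vec_in_col_span assms(10) by (auto simp: \<rho>_def L_def)
  then have ab: "a \<in> PM" "b \<in> PM"
    unfolding a_def b_def by (intro subspace_scale[OF subPM]; unfold PM_def; blast)+
  have ab_nz: "a \<noteq> 0 \<or> b \<noteq> 0"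
  proof (rule ccontr)
    assume "\<not> ?thesis"
    then have ab0: "P *v trig_vec \<rho> (\<i> ^ \<rho>) \<gamma> = 0" "P *v trig_vec \<rho> (- \<i> * \<i> ^ \<rho>) \<gamma> = 0"
      by (auto simp: a_def b_def)
    have "trig_vec \<rho> \<xi> \<gamma> \<in> L" for \<xi>
    proof -
      \<comment> \<open>\<open>\<i> ^ \<rho>\<close> and \<open>- \<i> * \<i> ^ \<rho>\<close> form
        a real basis of the complex numbers; \<open>z\<close> yields the coordinates of
        \<open>\<xi>\<close>.\<close>
      define z where "z = \<xi> / \<i> ^ \<rho>"
      have "of_real (Re z) + of_real (- Im z) * - \<i> = z" by (simp add: complex_eq_iff)
      then have "\<xi> = (of_real (Re z) + of_real (- Im z) * - \<i>) * \<i> ^ \<rho>"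
        by (simp only:) (simp add: z_def)
      then have "\<xi> = of_real (Re z) * \<i> ^ \<rho> + of_real (- Im z) * (- \<i> * \<i> ^ \<rho>)"
        by (simp add: algebra_simps)
      then have "P *v trig_vec \<rho> \<xi> \<gamma> = 0"
        using ab0 by (simp only: trig_vec_combination matrix_vector_right_distrib
            matrix_vector_mult_scaleR scaleR_zero_right add_0_left)
      then show ?thesis using P(2)[of "trig_vec \<rho> \<xi> \<gamma>"] by simp
    qed
    then have "columns (E_mat \<rho> \<gamma>) \<subseteq> L" by (auto simp: columns_E_mat_trig_vec)
    then show False using not_sub span_minimal[OF _ subL] by (auto simp: col_span_def)
  qed
  have bc_cont: "continuous_on UNIV bc" and Oc_cont: "continuous_on UNIV Oc"
    and sym: "\<And>y. transpose (Oc y) = Oc y"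
    using assms(6) by (auto simp: estimator_conditions_def)
  have T_meas: "T \<in> borel_measurable borel"
    unfolding assms(7) by (rule F_type_stat_measurable[OF bc_cont Oc_cont])
  have T_set: "{y. C \<le> T y} \<in> sets borel" for C
    using T_meas by measurable
  have neg: "negligible {y. det (Oc y) = 0}"
  proof -
    have "AE y in lborel. y \<notin> {y. det (Oc y) = 0}"
      using assms(6) by (simp add: estimator_conditions_def invertible_det_nz)
    moreover have "(\<lambda>y. det (Oc y)) \<in> borel_measurable borel"
      by (intro borel_measurable_continuous_onI continuous_on_det continuous_intros Oc_cont)
    then have "{y. det (Oc y) = 0} \<in> sets lborel" by measurable
    ultimately have "{y. det (Oc y) = 0} \<in> null_sets lborel"
      by (simp add: AE_iff_null_sets)
    then show ?thesis
      by (simp add: negligible_iff_null_sets null_sets_completionI)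
  qed
  have sup: "(SUP f\<in>F. measure (gaussian_measure \<mu>0 (\<sigma>2 *\<^sub>R Sigma_mat f)) {y. C \<le> T y}) = 1"
    if \<mu>0: "\<mu>0 \<in> M0 X R r" and \<sigma>2: "0 < \<sigma>2" for C \<mu>0 \<sigma>2
  proof -
    interpret prob_space "std_gaussian :: (real^('n::{finite,linorder})) measure" by (rule prob_space_std_gaussian)
    obtain \<beta> where \<beta>: "\<mu>0 = X *v \<beta>" "R *v \<beta> = r" using \<mu>0 by (auto simp: M0_def)
    define U where "U = large_F_set R r bc Oc C"
    obtain f h and B :: "nat \<Rightarrow> real^('n::{finite,linorder})^('n::{finite,linorder})" and Q where
      f: "\<And>m. f m \<in> spec_AR2" and h: "\<And>m. h m \<noteq> (0::real)"
      and B: "\<And>m. B m = (SOME B. B ** transpose B = \<sigma>2 *\<^sub>R Sigma_mat (f m))" "\<And>m. invertible (B m)"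
      and lim: "(\<lambda>m. h m *\<^sub>R (P ** B m)) \<longlonglongrightarrow> Q"
      and Q': "\<And>w. (norm (transpose Q *v w))\<^sup>2 = \<sigma>2 *
        ((w \<bullet> ((1 / fact \<rho>) *\<^sub>R (P *v trig_vec \<rho> (\<i> ^ \<rho>) \<gamma>)))\<^sup>2 +
         (w \<bullet> ((1 / fact \<rho>) *\<^sub>R (P *v trig_vec \<rho> (- \<i> * \<i> ^ \<rho>) \<gamma>)))\<^sup>2)"
      by (rule exists_concentrating_sequence[of \<rho> P \<gamma> \<sigma>2]) (erule Ptrig, rule \<sigma>2, rule that)
    note Q = Q'[folded a_def b_def]
    \<comment> \<open>By the formula for its norms, \<open>transpose Q\<close> annihilates the
      orthogonal complement of \<open>PM\<close>, so the range of \<open>Q\<close> lies in the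
      double complement.\<close>
    have Q_range: "Q *v z \<in> PM" for z
    proof -
      have "v \<bullet> (Q *v z) = 0" if "v \<in> PM\<^sup>\<bottom>" for v
      proof -
        have "v \<bullet> a = 0" "v \<bullet> b = 0"
          using that ab by (auto simp: orthogonal_comp_def orthogonal_def inner_commute)
        then have "transpose Q *v v = 0" using Q[of v] by simp
        then show ?thesis by (simp add: inner_matrix_vector)
      qed
      then have "Q *v z \<in> PM\<^sup>\<bottom>\<^sup>\<bottom>"
        by (auto simp: orthogonal_comp_def[of "PM\<^sup>\<bottom>"] orthogonal_def)
      then show ?thesis by (simp add: orthogonal_comp_self[OF subPM])
    qed
    obtain v where v: "transpose Q *v v \<noteq> 0"
    proof -
      obtain c where c: "c = a \<or> c = b" "c \<noteq> 0" using ab_nz by blast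
      then have "0 < (c \<bullet> a)\<^sup>2 + (c \<bullet> b)\<^sup>2"
        by (auto intro: add_pos_nonneg add_nonneg_pos)
      then have "transpose Q *v c \<noteq> 0" using Q[of c] \<sigma>2 by auto
      then show ?thesis by (rule that)
    qed
    \<comment> \<open>Outside a hyperplane, \<open>Q *v z\<close> is nonzero. Lifted from
      \<open>PM\<close> it is \<open>X *v (\<eta> - \<eta>')\<close>, and
      \<open>R *v \<eta> \<noteq> 0\<close>, as otherwise \<open>P\<close> would annihilate
      \<open>X *v \<eta>\<close>.\<close>
    have AE1: "AE z in std_gaussian. \<mu>0 + Q *v z \<in> U"
    proof -
      have "negligible {z. (transpose Q *v v) \<bullet> z = 0}"
        using v by (intro negligible_hyperplane) simp
      from AE_std_gaussian_negligible[OF this] show ?thesis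
      proof eventually_elim
        case (elim z)
        then have "Q *v z \<noteq> 0" using inner_matrix_vector[of v Q z] by auto
        moreover obtain \<eta> where \<eta>: "Q *v z = P *v (X *v \<eta>)"
          using Q_range[of z] by (auto simp: PM_def M)
        ultimately have "R *v \<eta> \<noteq> 0" using P(1)[of "X *v \<eta>"] by (auto simp: L_def M0_lin_def)
        moreover obtain \<eta>' where \<eta>': "X *v \<eta> - P *v (X *v \<eta>) = X *v \<eta>'" "R *v \<eta>' = 0"
          using P(2)[of "X *v \<eta>"] by (auto simp: L_def M0_lin_def)
        ultimately have "X *v \<beta> + X *v (\<eta> - \<eta>') \<in> U"
          unfolding U_def
          by (intro col_space_in_large_F_set[OF assms(6)] \<beta>) (simp add: matrix_vector_mult_diff_distrib)
        moreover have "X *v (\<eta> - \<eta>') = Q *v z"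
          using \<eta> \<eta>' by (simp add: matrix_vector_mult_diff_distrib algebra_simps)
        ultimately show ?case by (simp add: \<beta>)
      qed
    qed
    have AE2: "AE z in std_gaussian. \<forall>m. \<mu>0 + B m *v z \<notin> {y. det (Oc y) = 0}"
      unfolding AE_all_countable by (intro allI AE_affine_notin_negligible neg B(2))
    define S where "S m = {z. C \<le> T (\<mu>0 + B m *v z)}" for m
    have "(\<lambda>m. prob (S m)) \<longlonglongrightarrow> 1"
    proof (rule prob_tendsto_1_if_AE_eventually)
      show "S m \<in> events" for m
        unfolding S_def using T_meas by measurable
      show "AE z in std_gaussian. eventually (\<lambda>m. z \<in> S m) sequentially"
        using AE1 AE2
      proof eventually_elim
        case (elim z)
        have "(\<lambda>m. \<mu>0 + (h m *\<^sub>R (P ** B m)) *v z) \<longlonglongrightarrow> \<mu>0 + Q *v z"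
        proof (intro tendsto_intros)
          show "(\<lambda>m. (h m *\<^sub>R (P ** B m)) *v z) \<longlonglongrightarrow> Q *v z"
            unfolding matrix_vector_mult_def
            by (intro vec_tendstoI) (simp only: vec_lambda_beta, intro lim tendsto_intros)
        qed
        \<comment> \<open>The limit lies in an open set, hence so do the rescaled vectors modulo
          \<open>L\<close> eventually; invariance carries this over to the Gaussian vectors
          themselves.\<close>
        from topological_tendstoD[OF this open_large_F_set[OF bc_cont Oc_cont] elim(1)[unfolded U_def]]
        show ?case
        proof eventually_elim
          case (elim m)
          obtain \<eta> where \<eta>: "B m *v z - P *v (B m *v z) = X *v \<eta>" "R *v \<eta> = 0"
            using P(2)[of "B m *v z"] by (auto simp: L_def M0_lin_def)
          have "(h m *\<^sub>R (P ** B m)) *v z = h m *\<^sub>R (P *v (B m *v z))"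
            by (simp add: matrix_vector_mul_assoc scaleR_matrix_vector_assoc)
          also have "P *v (B m *v z) = B m *v z - X *v \<eta>" using \<eta>(1) by (simp add: algebra_simps)
          finally have "\<mu>0 + (h m *\<^sub>R (P ** B m)) *v z = X *v \<beta> + h m *\<^sub>R (B m *v z) + X *v (- h m *\<^sub>R \<eta>)"
            unfolding \<beta>(1) matrix_vector_mult_scaleR by (simp add: algebra_simps)
          moreover have "R *v (- h m *\<^sub>R \<eta>) = 0"
            by (simp only: matrix_vector_mult_scaleR \<eta>(2) scaleR_zero_right)
          note large_F_set_invariant[OF assms(6) \<beta>(2) this h]
          ultimately have "\<mu>0 + B m *v z \<in> large_F_set R r bc Oc C"
            using elim by (simp only: \<beta>(1))
          moreover have "det (Oc (\<mu>0 + B m *v z)) \<noteq> 0"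
            using \<open>\<forall>m. \<mu>0 + B m *v z \<notin> {y. det (Oc y) = 0}\<close> by simp
          ultimately show ?case
            using F_type_stat_ge[OF sym assms(8)] by (simp add: S_def assms(7))
        qed
      qed
    qed
    moreover have "prob (S m) = measure (gaussian_measure \<mu>0 (\<sigma>2 *\<^sub>R Sigma_mat (f m))) {y. C \<le> T y}" for m
      by (simp add: measure_gaussian_measure[OF T_set] S_def B(1))
    ultimately have lim1: "(\<lambda>m. measure (gaussian_measure \<mu>0 (\<sigma>2 *\<^sub>R Sigma_mat (f m))) {y. C \<le> T y}) \<longlonglongrightarrow> 1"
      by simp
    let ?p = "\<lambda>f. measure (gaussian_measure \<mu>0 (\<sigma>2 *\<^sub>R Sigma_mat f)) {y. C \<le> T y}"
    have le1: "?p g \<le> 1" for g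
      by (simp add: measure_gaussian_measure[OF T_set])
    \<comment> \<open>The bound 1 on probabilities makes the supremum over reals meaningful; the
      sequence lies in \<open>F\<close> because \<open>spec_AR2 \<subseteq> F\<close>.\<close>
    have "?p (f m) \<le> (SUP f\<in>F. ?p f)" for m
      using f assms(5) le1 by (intro cSUP_upper bdd_aboveI2[of _ _ 1]) auto
    then have "1 \<le> (SUP f\<in>F. ?p f)"
      using lim1 by (intro LIMSEQ_le_const2) auto
    moreover have "(SUP f\<in>F. ?p f) \<le> 1"
      by (rule cSUP_least) (use f assms(5) le1 in auto)
    ultimately show ?thesis by (rule antisym[rotated])
  qed
  show ?thesis using kappa sup by (simp add: L_def)
qed

end
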